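(* There is a real $A\in 2^{\omega}$ that is weakly low for $K$ but is not in $\mathcal{LK}(\Delta^0_2)$.
   Context: Reals are elements of $2^{\omega}$ (infinite binary sequences). $K(\sigma)$ is the prefix-free Kolmogorov complexity of the finite binary string $\sigma\in 2^{<\omega}$ with respect to a fixed universal prefix-free (oracle) machine, and $K^A(\sigma)$ is its relativization to the oracle $A$. An order is a function that is nondecreasing and unbounded (not necessarily recursive); for functions $f:2^{<\omega}\to\omega$, strings are taken in length-lexicographic order (identifying $2^{<\omega}$ with $\omega$). For $f:2^{<\omega}\to\omega$, $\mathcal{LK}(f)$ is the set of reals $A$ for which there is a constant $c$ such that for all $\sigma\in 2^{<\omega}$, $K(\sigma)\leq K^A(\sigma)+f(\sigma)+c$. $\mathcal{LK}(\Delta^0_2)$ is the intersection of $\mathcal{LK}(f)$ over all $\Delta^0_2$ orders $f$. A real $A$ is weakly low for $K$ if there is a constant $c$ such that $K(\sigma)\leq K^A(\sigma)+c$ for infinitely many $\sigma\in 2^{<\omega}$. *)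

theory Defs
  imports "HOL-Library.Sublist"
begin

section \<open>Strings and reals\<close>

type_synonym str = "bool list"
type_synonym cantor = "nat \<Rightarrow> bool"

abbreviation empty_oracle :: cantor where
  "empty_oracle \<equiv> \<lambda>_. False"

text \<open>The identification of binary strings with natural numbers along the length-lexicographic
  order: the empty string, 0, 1, 00, 01, 10, 11, 000, \<dots> receive 0, 1, 2, 3, \<dots>.
  Lemmas \<open>bij_str_code\<close> and \<open>str_code_less_iff\<close> confirm this.\<close>

definition str_code :: "str \<Rightarrow> nat" where
  "str_code \<sigma> = foldl (\<lambda>n b. 2 * n + (if b then 2 else 1)) 0 \<sigma>"

lemma str_code_Nil [simp]: "str_code [] = 0"
  by (simp add: str_code_def)

lemma str_code_snoc [simp]:
  "str_code (\<sigma> @ [b]) = 2 * str_code \<sigma> + (if b then 2 else 1)"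
  by (simp add: str_code_def)

lemma bij_str_code: "bij str_code"
proof (rule bijI)
  have "str_code \<sigma> = str_code \<tau> \<Longrightarrow> \<sigma> = \<tau>" for \<sigma> \<tau>
  proof (induction \<sigma> arbitrary: \<tau> rule: rev_induct)
    case Nil
    then show ?case by (cases \<tau> rule: rev_cases) (auto split: if_splits)
  next
    case (snoc b \<sigma>)
    show ?case
    proof (cases \<tau> rule: rev_cases)
      case Nil
      with snoc.prems show ?thesis by (simp split: if_splits)
    next
      case (snoc \<tau>' b')
      with snoc.prems have "b = b' \<and> str_code \<sigma> = str_code \<tau>'"
        by (auto split: if_splits) presburger+
      with snoc.IH snoc show ?thesis by simp
    qed
  qed
  then show "inj str_code" by (rule injI)
  have "\<exists>\<sigma>. n = str_code \<sigma>" for n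
  proof (induction n rule: less_induct)
    case (less n)
    show ?case
    proof (cases "n = 0")
      case True
      then show ?thesis by (metis str_code_Nil)
    next
      case False
      then have "(n - 1) div 2 < n" by linarith
      then obtain \<sigma> where s: "(n - 1) div 2 = str_code \<sigma>"
        using less by blast
      have "n = str_code (\<sigma> @ [even n])"
        using False by (simp flip: s) presburger
      then show ?thesis by blast
    qed
  qed
  then show "surj str_code" by (auto simp: surj_def)
qed

lemma str_code_range:
  "2 ^ length \<sigma> \<le> Suc (str_code \<sigma>) \<and> Suc (str_code \<sigma>) < 2 ^ Suc (length \<sigma>)"
  by (induction \<sigma> rule: rev_induct) auto

lemma str_code_append:
  "str_code (\<sigma> @ \<tau>) = 2 ^ length \<tau> * str_code \<sigma> + str_code \<tau>"
  by (induction \<tau> rule: rev_induct) (auto simp: algebra_simps simp flip: append_assoc)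

lemma str_code_less_iff:
  "str_code \<sigma> < str_code \<tau> \<longleftrightarrow> (\<sigma>, \<tau>) \<in> lenlex {(False, True)}"
proof -
  have short: "str_code \<alpha> < str_code \<beta>" if "length \<alpha> < length \<beta>" for \<alpha> \<beta>
  proof -
    have "(2::nat) ^ Suc (length \<alpha>) \<le> 2 ^ length \<beta>"
      using that by (intro power_increasing) auto
    then show ?thesis
      using str_code_range[of \<alpha>] str_code_range[of \<beta>] by linarith
  qed
  have up: "str_code \<alpha> < str_code \<beta>" if "(\<alpha>, \<beta>) \<in> lenlex {(False, True)}" for \<alpha> \<beta>
  proof (cases "length \<alpha> < length \<beta>")
    case False
    with that obtain ps xs ys where len: "length \<alpha> = length \<beta>"
      and \<alpha>: "\<alpha> = ps @ False # xs" and \<beta>: "\<beta> = ps @ True # ys"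
      by (auto simp: lenlex_conv lex_conv)
    have c: "str_code (ps @ b # zs) =
        2 ^ length zs * (2 * str_code ps + (if b then 2 else 1)) + str_code zs" for b zs
      using str_code_append[of "ps @ [b]" zs] by simp
    show ?thesis
      using str_code_range[of xs] str_code_range[of ys] len
      unfolding \<alpha> \<beta> by (simp add: c algebra_simps)
  qed (rule short)
  have tot: "total (lenlex {(False, True)})"
    by (rule total_lenlex) (auto simp: total_on_def)
  show ?thesis
    using up tot by (metis UNIV_I less_asym less_irrefl total_on_def)
qed


section \<open>Oracle computability\<close>

text \<open>Partial recursive functions relative to an oracle, presented by programs
  acting on tuples of natural numbers: \<open>oeval X p xs y\<close> says that program \<open>p\<close> with oracle \<open>X\<close>
  halts on \<open>xs\<close> with value \<open>y\<close>.  Nonoracular computability is computability with the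
  empty oracle.\<close>

datatype recf =
    Zero
  | Succ
  | Proj nat
  | Query
  | Comp recf "recf list"
  | PrimRec recf recf
  | Mu recf

inductive oeval :: "cantor \<Rightarrow> recf \<Rightarrow> nat list \<Rightarrow> nat \<Rightarrow> bool" for X :: cantor where
  oeval_Zero: "oeval X Zero xs 0"
| oeval_Succ: "oeval X Succ [x] (Suc x)"
| oeval_Proj: "i < length xs \<Longrightarrow> oeval X (Proj i) xs (xs ! i)"
| oeval_Query: "oeval X Query [x] (if X x then 1 else 0)"
| oeval_Comp: "list_all2 (\<lambda>g y. oeval X g xs y) gs ys \<Longrightarrow> oeval X f ys z \<Longrightarrow>
    oeval X (Comp f gs) xs z"
| oeval_PrimRec_0: "oeval X f xs y \<Longrightarrow> oeval X (PrimRec f g) (0 # xs) y"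
| oeval_PrimRec_Suc: "oeval X (PrimRec f g) (n # xs) r \<Longrightarrow> oeval X g (n # r # xs) y \<Longrightarrow>
    oeval X (PrimRec f g) (Suc n # xs) y"
| oeval_Mu: "oeval X f (n # xs) 0 \<Longrightarrow> (\<forall>m<n. \<exists>k. oeval X f (m # xs) (Suc k)) \<Longrightarrow>
    oeval X (Mu f) xs n"

text \<open>A functional from reals and strings to strings is partial computable if a single program
  computes it uniformly in the oracle.\<close>

definition partial_computable :: "(cantor \<Rightarrow> str \<Rightarrow> str option) \<Rightarrow> bool" where
  "partial_computable M \<longleftrightarrow>
    (\<exists>p. \<forall>X \<sigma> \<tau>. M X \<sigma> = Some \<tau> \<longleftrightarrow> oeval X p [str_code \<sigma>] (str_code \<tau>))"


section \<open>Prefix-free complexity\<close>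

definition prefix_free :: "str set \<Rightarrow> bool" where
  "prefix_free S \<longleftrightarrow> (\<forall>\<sigma>\<in>S. \<forall>\<tau>\<in>S. prefix \<sigma> \<tau> \<longrightarrow> \<sigma> = \<tau>)"

definition prefix_free_machine :: "(cantor \<Rightarrow> str \<Rightarrow> str option) \<Rightarrow> bool" where
  "prefix_free_machine M \<longleftrightarrow> partial_computable M \<and> (\<forall>X. prefix_free (dom (M X)))"

definition universal_machine :: "(cantor \<Rightarrow> str \<Rightarrow> str option) \<Rightarrow> bool" where
  "universal_machine U \<longleftrightarrow> prefix_free_machine U \<and>
    (\<forall>M. prefix_free_machine M \<longrightarrow> (\<exists>\<rho>. \<forall>X \<sigma>. U X (\<rho> @ \<sigma>) = M X \<sigma>))"

text \<open>For universal \<open>U\<close> every string has a description, so the minimum is taken over a nonempty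
  set.\<close>

definition KO :: "(cantor \<Rightarrow> str \<Rightarrow> str option) \<Rightarrow> cantor \<Rightarrow> str \<Rightarrow> nat" where
  "KO U X \<sigma> = (LEAST n. \<exists>\<tau>. length \<tau> = n \<and> U X \<tau> = Some \<sigma>)"

abbreviation K :: "(cantor \<Rightarrow> str \<Rightarrow> str option) \<Rightarrow> str \<Rightarrow> nat" where
  "K U \<equiv> KO U empty_oracle"


section \<open>Orders in \<open>\<Delta>\<^sup>0\<^sub>2\<close>\<close>

definition computable_rel :: "nat \<Rightarrow> (nat list \<Rightarrow> bool) \<Rightarrow> bool" where
  "computable_rel k R \<longleftrightarrow>
    (\<exists>p. \<forall>xs. length xs = k \<longrightarrow> oeval empty_oracle p xs (if R xs then 1 else 0))"

definition Sigma02 :: "nat \<Rightarrow> (nat list \<Rightarrow> bool) \<Rightarrow> bool" where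
  "Sigma02 k P \<longleftrightarrow> (\<exists>R. computable_rel (k + 2) R \<and>
    (\<forall>xs. length xs = k \<longrightarrow> (P xs \<longleftrightarrow> (\<exists>u. \<forall>v. R (u # v # xs)))))"

definition Pi02 :: "nat \<Rightarrow> (nat list \<Rightarrow> bool) \<Rightarrow> bool" where
  "Pi02 k P \<longleftrightarrow> (\<exists>R. computable_rel (k + 2) R \<and>
    (\<forall>xs. length xs = k \<longrightarrow> (P xs \<longleftrightarrow> (\<forall>u. \<exists>v. R (u # v # xs)))))"

definition Delta02 :: "nat \<Rightarrow> (nat list \<Rightarrow> bool) \<Rightarrow> bool" where
  "Delta02 k P \<longleftrightarrow> Sigma02 k P \<and> Pi02 k P"

definition Delta02_fun :: "(str \<Rightarrow> nat) \<Rightarrow> bool" where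
  "Delta02_fun f \<longleftrightarrow> Delta02 2 (\<lambda>xs. \<exists>\<sigma>. xs = [str_code \<sigma>, f \<sigma>])"

definition is_order :: "(str \<Rightarrow> nat) \<Rightarrow> bool" where
  "is_order f \<longleftrightarrow>
    (\<forall>\<sigma> \<tau>. str_code \<sigma> \<le> str_code \<tau> \<longrightarrow> f \<sigma> \<le> f \<tau>) \<and> (\<forall>n. \<exists>\<sigma>. n \<le> f \<sigma>)"


section \<open>Lowness notions\<close>

definition LK :: "(cantor \<Rightarrow> str \<Rightarrow> str option) \<Rightarrow> (str \<Rightarrow> nat) \<Rightarrow> cantor set" where
  "LK U f = {A. \<exists>c. \<forall>\<sigma>. K U \<sigma> \<le> KO U A \<sigma> + f \<sigma> + c}"

definition LK_Delta02 :: "(cantor \<Rightarrow> str \<Rightarrow> str option) \<Rightarrow> cantor set" where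
  "LK_Delta02 U = (\<Inter>f\<in>{f. Delta02_fun f \<and> is_order f}. LK U f)"

definition weakly_low_for_K :: "(cantor \<Rightarrow> str \<Rightarrow> str option) \<Rightarrow> cantor \<Rightarrow> bool" where
  "weakly_low_for_K U A \<longleftrightarrow> (\<exists>c. infinite {\<sigma>. K U \<sigma> \<le> KO U A \<sigma> + c})"

end

theory Submission
  imports Defs "HOL-Probability.Probability"
begin

text \<open>Let \<open>A\<close> be chosen by independent fair coin tosses; both properties hold with probability
  at least 3/4.

  Weak lowness: the mean \<open>W(y)\<close> over all oracles of the total weight \<open>2 ^ -|\<tau>|\<close> of the
  descriptions \<open>\<tau>\<close> of \<open>y\<close> can be approximated from below.  If \<open>t s\<close> is the total weight
  found within \<open>s\<close> stages for outputs below \<open>s\<close>, then giving \<open>s\<close> a description that occupies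
  part of the interval from \<open>t s\<close> to \<open>t (s + 1)\<close> shows that \<open>2 ^ -K(s)\<close> is at least a
  constant times \<open>t (s + 1) - t s\<close>.  Outputs \<open>y \<ge> N\<close> contribute nothing to \<open>t N\<close>, so
  \<open>\<Sum>y\<ge>N. W(y) \<le> \<Sum>y\<ge>N. (t (y + 1) - t y)\<close>; hence \<open>W(y) \<le> C * 2 ^ -K(y)\<close> for infinitely
  many \<open>y\<close>.  For these, Markov's inequality gives \<open>K(y) \<le> K\<^sup>A(y) + d\<close> with probability at
  least 3/4.

  Failure of membership: \<open>A\<close> computes its own initial segment of length \<open>3 n\<close> from a
  description of length \<open>n + O(1)\<close>, while that segment is incompressible for infinitely many
  \<open>n\<close>.  This refutes membership for the order \<open>|\<sigma>| div 3\<close>.\<close>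

section \<open>Uniformly oracle-computable functions\<close>

text \<open>A single program serves all oracles, as \<open>partial_computable\<close> asks of
  machines. Functions are total on tuples of the fixed length k.\<close>

definition ocomputable :: "nat \<Rightarrow> (cantor \<Rightarrow> nat list \<Rightarrow> nat) \<Rightarrow> bool" where
  "ocomputable k f \<longleftrightarrow> (\<exists>p. \<forall>X xs. length xs = k \<longrightarrow> oeval X p xs (f X xs))"

definition ocomputable_list :: "nat \<Rightarrow> nat \<Rightarrow> (cantor \<Rightarrow> nat list \<Rightarrow> nat list) \<Rightarrow> bool" where
  "ocomputable_list k m F \<longleftrightarrow> (\<exists>gs. length gs = m \<and>
    (\<forall>X xs. length xs = k \<longrightarrow> list_all2 (\<lambda>g y. oeval X g xs y) gs (F X xs)))"

definition odecidable :: "nat \<Rightarrow> (cantor \<Rightarrow> nat list \<Rightarrow> bool) \<Rightarrow> bool" where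
  "odecidable k P \<longleftrightarrow> ocomputable k (\<lambda>X xs. of_bool (P X xs))"

named_theorems ocomp

section \<open>Closure under substitution and primitive recursion\<close>

lemma ocomputable_cong:
  "ocomputable k f \<Longrightarrow> (\<And>X xs. length xs = k \<Longrightarrow> f X xs = g X xs) \<Longrightarrow> ocomputable k g"
  unfolding ocomputable_def by metis

lemma ocomputable_subst:
  assumes "ocomputable_list k m F" "ocomputable m f"
  shows "ocomputable k (\<lambda>X xs. f X (F X xs))"
proof -
  obtain gs where gs: "length gs = m"
    "\<And>X xs. length xs = k \<Longrightarrow> list_all2 (\<lambda>g y. oeval X g xs y) gs (F X xs)"
    using assms(1) unfolding ocomputable_list_def by blast
  obtain p where p: "\<And>X xs. length xs = m \<Longrightarrow> oeval X p xs (f X xs)"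
    using assms(2) unfolding ocomputable_def by blast
  have "oeval X (Comp p gs) xs (f X (F X xs))" if "length xs = k" for X xs
    using oeval_Comp[OF gs(2)[OF that] p] gs(2)[OF that] gs(1)
    by (metis list_all2_lengthD)
  then show ?thesis unfolding ocomputable_def by blast
qed

lemma ocomputable_list_Nil [ocomp]: "ocomputable_list k 0 (\<lambda>X xs. [])"
  unfolding ocomputable_list_def by simp

lemma ocomputable_list_Cons [ocomp]:
  assumes "ocomputable k f" "ocomputable_list k m F"
  shows "ocomputable_list k (Suc m) (\<lambda>X xs. f X xs # F X xs)"
proof -
  obtain gs where "length gs = m"
    "\<And>X xs. length xs = k \<Longrightarrow> list_all2 (\<lambda>g y. oeval X g xs y) gs (F X xs)"
    using assms(2) unfolding ocomputable_list_def by blast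
  moreover obtain p where "\<And>X xs. length xs = k \<Longrightarrow> oeval X p xs (f X xs)"
    using assms(1) unfolding ocomputable_def by blast
  ultimately show ?thesis
    unfolding ocomputable_list_def by (intro exI[of _ "p # gs"]) simp
qed

lemma ocomputable_list_id [ocomp]: "ocomputable_list k k (\<lambda>X xs. xs)"
  unfolding ocomputable_list_def
  by (intro exI[of _ "map Proj [0..<k]"]) (auto simp: list_all2_conv_all_nth intro: oeval_Proj)

lemma ocomputable_list_tl:
  assumes "ocomputable_list k (Suc m) F"
  shows "ocomputable_list k m (\<lambda>X xs. tl (F X xs))"
proof -
  obtain gs where gs: "length gs = Suc m"
    "\<And>X xs. length xs = k \<Longrightarrow> list_all2 (\<lambda>g y. oeval X g xs y) gs (F X xs)"
    using assms unfolding ocomputable_list_def by blast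
  obtain g gs' where g: "gs = g # gs'" using gs(1) by (cases gs) auto
  show ?thesis
    unfolding ocomputable_list_def
    using gs unfolding g by (intro exI[of _ gs']) (simp add: list_all2_Cons1, metis list.sel(3))
qed

lemma ocomputable_hd:
  assumes "ocomputable_list k (Suc m) F"
  shows "ocomputable k (\<lambda>X xs. hd (F X xs))"
proof -
  obtain gs where gs: "length gs = Suc m"
    "\<And>X xs. length xs = k \<Longrightarrow> list_all2 (\<lambda>g y. oeval X g xs y) gs (F X xs)"
    using assms unfolding ocomputable_list_def by blast
  obtain g gs' where g: "gs = g # gs'" using gs(1) by (cases gs) auto
  show ?thesis
    unfolding ocomputable_def
    using gs unfolding g by (intro exI[of _ g]) (simp add: list_all2_Cons1, metis list.sel(1))
qed

text \<open>Arguments are addressed by \<open>hd\<close> and \<open>tl\<close> as in a de Bruijn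
  context, where each bound variable is pushed on the front. With these access rules
  \<open>intro ocomp\<close> settles computability by following the syntax of a term.\<close>

lemmas ocomputable_list_tl1 [ocomp] = ocomputable_list_tl[OF ocomputable_list_id]
lemmas ocomputable_list_tl2 [ocomp] = ocomputable_list_tl[OF ocomputable_list_tl1]
lemmas ocomputable_list_tl3 [ocomp] = ocomputable_list_tl[OF ocomputable_list_tl2]
lemmas ocomputable_list_tl4 [ocomp] = ocomputable_list_tl[OF ocomputable_list_tl3]
lemmas ocomputable_list_tl5 [ocomp] = ocomputable_list_tl[OF ocomputable_list_tl4]

lemmas ocomputable_hds [ocomp] = ocomputable_hd[OF ocomputable_list_id]
  ocomputable_hd[OF ocomputable_list_tl1] ocomputable_hd[OF ocomputable_list_tl2]
  ocomputable_hd[OF ocomputable_list_tl3] ocomputable_hd[OF ocomputable_list_tl4]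

lemma ocomputable_list_map:
  assumes "\<And>g. g \<in> set gs \<Longrightarrow> ocomputable k (h g)"
  shows "ocomputable_list k (length gs) (\<lambda>X xs. map (\<lambda>g. h g X xs) gs)"
  using assms by (induction gs) (simp_all add: ocomp)

lemma ocomputable_nth:
  assumes "ocomputable_list k m F" "i < m"
  shows "ocomputable k (\<lambda>X xs. F X xs ! i)"
  by (rule ocomputable_subst[OF assms(1)])
    (use assms(2) in \<open>auto simp: ocomputable_def intro!: exI[of _ "Proj i"] oeval_Proj\<close>)

lemma ocomputable_Suc [ocomp]:
  assumes "ocomputable k f"
  shows "ocomputable k (\<lambda>X xs. Suc (f X xs))"
proof -
  have "ocomputable (Suc 0) (\<lambda>X xs. Suc (hd xs))"
    unfolding ocomputable_def
    by (intro exI[of _ Succ]) (auto simp: length_Suc_conv intro: oeval_Succ)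
  from ocomputable_subst[OF _ this, of k "\<lambda>X xs. [f X xs]"] show ?thesis
    by (simp add: ocomp assms)
qed

lemma ocomputable_Query [ocomp]:
  assumes "ocomputable k f"
  shows "ocomputable k (\<lambda>X xs. of_bool (X (f X xs)))"
proof -
  have "ocomputable (Suc 0) (\<lambda>X xs. of_bool (X (hd xs)))"
    unfolding ocomputable_def
    using oeval_Query[of X x for X x, folded of_bool_def]
    by (intro exI[of _ Query]) (metis length_0_conv length_Suc_conv list.sel(1))
  from ocomputable_subst[OF _ this, of k "\<lambda>X xs. [f X xs]"] show ?thesis
    by (simp add: ocomp assms)
qed

lemma ocomputable_const [ocomp]: "ocomputable k (\<lambda>X xs. c)"
proof (induction c)
  case 0
  then show ?case
    unfolding ocomputable_def by (intro exI[of _ Zero]) (auto intro: oeval_Zero)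
qed (rule ocomputable_Suc)

text \<open>The arithmetic operations below are rewritten into \<open>rec_nat\<close> and so reduced
  to this rule. The step function finds the index and the previous value in front of the
  parameters.\<close>

lemma ocomputable_rec [ocomp]:
  assumes n: "ocomputable k n" and f: "ocomputable k f"
    and g: "ocomputable (Suc (Suc k)) (\<lambda>X ys. g X (hd ys) (hd (tl ys)) (tl (tl ys)))"
  shows "ocomputable k (\<lambda>X xs. rec_nat (f X xs) (\<lambda>i r. g X i r xs) (n X xs))"
proof -
  obtain p where p: "\<And>X xs. length xs = k \<Longrightarrow> oeval X p xs (f X xs)"
    using f unfolding ocomputable_def by blast
  obtain q where q: "\<And>X ys. length ys = Suc (Suc k) \<Longrightarrow>
      oeval X q ys (g X (hd ys) (hd (tl ys)) (tl (tl ys)))"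
    using g unfolding ocomputable_def by blast
  have "oeval X (PrimRec p q) (m # xs) (rec_nat (f X xs) (\<lambda>i r. g X i r xs) m)"
    if "length xs = k" for X xs m
  proof (induction m)
    case (Suc m)
    show ?case
      using oeval_PrimRec_Suc[OF Suc q[of "m # _ # xs" X]] that by simp
  qed (simp add: oeval_PrimRec_0 p that)
  then have "ocomputable (Suc k)
      (\<lambda>X ys. rec_nat (f X (tl ys)) (\<lambda>i r. g X i r (tl ys)) (hd ys))"
    unfolding ocomputable_def
    by (intro exI[of _ "PrimRec p q"]) (auto simp: length_Suc_conv)
  from ocomputable_subst[OF _ this, of k "\<lambda>X xs. n X xs # xs"] show ?thesis
    by (simp add: ocomp n)
qed

section \<open>Arithmetic\<close>

lemma ocomputable_add [ocomp]:
  assumes "ocomputable k f" "ocomputable k g"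
  shows "ocomputable k (\<lambda>X xs. f X xs + g X xs)"
proof -
  have eq: "a + b = rec_nat a (\<lambda>i r. Suc r) b" for a b :: nat
    by (induction b) auto
  show ?thesis unfolding eq by (intro ocomp assms)
qed

lemma ocomputable_mult [ocomp]:
  assumes "ocomputable k f" "ocomputable k g"
  shows "ocomputable k (\<lambda>X xs. f X xs * g X xs)"
proof -
  have eq: "a * b = rec_nat 0 (\<lambda>i r. r + a) b" for a b :: nat
    by (induction b) auto
  have "ocomputable (Suc (Suc k)) (\<lambda>X ys. f X (tl (tl ys)))"
    by (rule ocomputable_subst[OF _ assms(1)]) (intro ocomp)
  then show ?thesis unfolding eq by (intro ocomp assms)
qed

lemma ocomputable_power [ocomp]:
  assumes "ocomputable k f" "ocomputable k g"
  shows "ocomputable k (\<lambda>X xs. f X xs ^ g X xs)"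
proof -
  have eq: "a ^ b = rec_nat 1 (\<lambda>i r. r * a) b" for a b :: nat
    by (induction b) auto
  have "ocomputable (Suc (Suc k)) (\<lambda>X ys. f X (tl (tl ys)))"
    by (rule ocomputable_subst[OF _ assms(1)]) (intro ocomp)
  then show ?thesis unfolding eq by (intro ocomp assms)
qed

lemma ocomputable_diff [ocomp]:
  assumes "ocomputable k f" "ocomputable k g"
  shows "ocomputable k (\<lambda>X xs. f X xs - g X xs)"
proof -
  \<comment> \<open>Predecessor is the recursion that returns its own index; iterating it gives
    truncated subtraction.\<close>
  have pred: "a - 1 = rec_nat 0 (\<lambda>i r. i) a" for a :: nat
    by (cases a) auto
  have eq: "a - b = rec_nat a (\<lambda>i r. rec_nat 0 (\<lambda>i r. i) r) b" for a b :: nat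
    unfolding pred[symmetric] by (induction b) auto
  show ?thesis unfolding eq by (intro ocomp assms)
qed

lemma ocomputable_sum [ocomp]:
  assumes "ocomputable k n" "ocomputable (Suc k) (\<lambda>X ys. g X (hd ys) (tl ys))"
  shows "ocomputable k (\<lambda>X xs. \<Sum>i<n X xs. g X i xs)"
proof -
  have eq: "(\<Sum>i<m. h i) = rec_nat 0 (\<lambda>i r. r + h i) m" for m and h :: "nat \<Rightarrow> nat"
    by (induction m) auto
  have "ocomputable (Suc (Suc k)) (\<lambda>X ys. g X (hd ys) (tl (tl ys)))"
    using ocomputable_subst[OF _ assms(2), of "Suc (Suc k)" "\<lambda>X ys. hd ys # tl (tl ys)"]
    by (simp add: ocomp)
  then show ?thesis unfolding eq by (intro ocomp assms)
qed

section \<open>Decidable predicates and definitions by cases\<close>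

lemma ocomputable_of_bool [ocomp]:
  "odecidable k P \<Longrightarrow> ocomputable k (\<lambda>X xs. of_bool (P X xs))"
  unfolding odecidable_def .

lemma odecidable_le [ocomp]:
  assumes "ocomputable k f" "ocomputable k g"
  shows "odecidable k (\<lambda>X xs. f X xs \<le> g X xs)"
proof -
  have eq: "of_bool (a \<le> b) = 1 - (a - b)" for a b :: nat by simp
  show ?thesis unfolding odecidable_def eq by (intro ocomp assms)
qed

lemma odecidable_not [ocomp]:
  assumes "odecidable k P"
  shows "odecidable k (\<lambda>X xs. \<not> P X xs)"
proof -
  have eq: "of_bool (\<not> a) = 1 - (of_bool a :: nat)" for a by simp
  show ?thesis unfolding odecidable_def eq by (intro ocomp assms)
qed

lemma odecidable_conj [ocomp]:
  assumes "odecidable k P" "odecidable k Q"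
  shows "odecidable k (\<lambda>X xs. P X xs \<and> Q X xs)"
proof -
  have eq: "of_bool (a \<and> b) = of_bool a * (of_bool b :: nat)" for a b by simp
  show ?thesis unfolding odecidable_def eq by (intro ocomp assms)
qed

lemma odecidable_less [ocomp]:
  assumes "ocomputable k f" "ocomputable k g"
  shows "odecidable k (\<lambda>X xs. f X xs < g X xs)"
  unfolding linorder_not_le[symmetric] by (intro ocomp assms)

lemma odecidable_eq [ocomp]:
  assumes "ocomputable k f" "ocomputable k g"
  shows "odecidable k (\<lambda>X xs. f X xs = g X xs)"
  unfolding order_eq_iff by (intro ocomp assms)

lemma odecidable_all_less [ocomp]:
  assumes "ocomputable k n" "odecidable (Suc k) (\<lambda>X ys. P X (hd ys) (tl ys))"
  shows "odecidable k (\<lambda>X xs. \<forall>i<n X xs. P X i xs)"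
proof -
  \<comment> \<open>A bounded universal quantifier holds iff its counterexamples number 0.\<close>
  have eq: "(\<forall>i<m. Q i) \<longleftrightarrow> (\<Sum>i<m. of_bool (\<not> Q i)) = (0 :: nat)" for m :: nat and Q
    by (auto simp: of_bool_def split: if_splits)
  show ?thesis unfolding eq by (intro ocomp assms)
qed

lemma odecidable_ball_set:
  assumes "\<And>g. g \<in> set gs \<Longrightarrow> odecidable k (P g)"
  shows "odecidable k (\<lambda>X xs. \<forall>g\<in>set gs. P g X xs)"
  using assms
proof (induction gs)
  case Nil
  then show ?case by (simp add: odecidable_def ocomp)
qed (simp add: ocomp)

lemma ocomputable_if [ocomp]:
  assumes "odecidable k P" "ocomputable k f" "ocomputable k g"
  shows "ocomputable k (\<lambda>X xs. if P X xs then f X xs else g X xs)"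
proof -
  have eq: "(if a then b else c) = of_bool a * b + of_bool (\<not> a) * c" for a and b c :: nat
    by simp
  show ?thesis unfolding eq by (intro ocomp assms)
qed

lemma ocomputable_div [ocomp]:
  assumes "ocomputable k f" "ocomputable k g"
  shows "ocomputable k (\<lambda>X xs. f X xs div g X xs)"
proof -
  \<comment> \<open>For positive b the quotient counts the q with \<open>Suc q * b \<le> a\<close>,
    and all of these lie below a.\<close>
  have eq: "a div b = (if b = 0 then 0 else \<Sum>q<a. of_bool (Suc q * b \<le> a))" for a b :: nat
  proof (cases "b = 0")
    case False
    have "Suc q * b \<le> a \<longleftrightarrow> q < a div b" for q
      using False by (metis Suc_le_eq less_eq_div_iff_mult_less_eq bot_nat_0.not_eq_extremum)
    then have "(\<Sum>q<a. of_bool (Suc q * b \<le> a)) = (\<Sum>q<a. of_bool (q < a div b) :: nat)"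
      by simp
    also have "\<dots> = card ({..<a} \<inter> {..<a div b})"
      by (simp add: sum_of_bool_eq lessThan_def)
    also have "{..<a} \<inter> {..<a div b} = {..<a div b}"
      by (auto intro: order_less_le_trans[OF _ div_le_dividend])
    finally show ?thesis using False by simp
  qed simp
  have "ocomputable (Suc k) (\<lambda>X ys. f X (tl ys))" "ocomputable (Suc k) (\<lambda>X ys. g X (tl ys))"
    by (rule ocomputable_subst[OF _ assms(1)] ocomputable_subst[OF _ assms(2)], intro ocomp)+
  then show ?thesis unfolding eq by (intro ocomp assms)
qed

text \<open>Finite oracles are coded by numbers through \<open>bit\<close>; decidability of
  \<open>bit\<close> lets computations simulate them.\<close>

lemma odecidable_bit [ocomp]:
  assumes "ocomputable k f" "ocomputable k g"
  shows "odecidable k (\<lambda>X xs. bit (f X xs :: nat) (g X xs))"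
proof -
  have eq: "bit a x \<longleftrightarrow> 2 * (a div 2 ^ x div 2) \<noteq> a div 2 ^ x" for a x :: nat
    unfolding bit_iff_odd
    using even_two_times_div_two[of "a div 2 ^ x"] by (metis dvd_triv_left)
  show ?thesis unfolding eq by (intro ocomp assms)
qed

section \<open>Evaluation in bounded stages\<close>

text \<open>\<open>evn X s p xs\<close> is \<open>Suc y\<close> if the computation of \<open>p\<close> on \<open>xs\<close> yields \<open>y\<close> with oracle
  queries and unbounded searches restricted to numbers below \<open>s\<close>, and is 0 otherwise.  The sum
  in the clause for \<open>Mu\<close> has at most one nonzero summand.\<close>

fun evn :: "cantor \<Rightarrow> nat \<Rightarrow> recf \<Rightarrow> nat list \<Rightarrow> nat" where
  "evn X s Zero xs = 1"
| "evn X s Succ xs = (if length xs = 1 then Suc (Suc (hd xs)) else 0)"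
| "evn X s (Proj i) xs = (if i < length xs then Suc (xs ! i) else 0)"
| "evn X s Query xs = (if length xs = 1 \<and> hd xs < s then Suc (of_bool (X (hd xs))) else 0)"
| "evn X s (Comp f gs) xs =
    (if \<forall>g\<in>set gs. evn X s g xs \<noteq> 0
     then evn X s f (map (\<lambda>g. evn X s g xs - 1) gs) else 0)"
| "evn X s (PrimRec f g) xs =
    (if length xs = 0 then 0
     else rec_nat (evn X s f (tl xs))
       (\<lambda>i r. if r = 0 then 0 else evn X s g (i # (r - 1) # tl xs)) (hd xs))"
| "evn X s (Mu f) xs =
    (\<Sum>n<s. Suc n * of_bool (evn X s f (n # xs) = 1 \<and> (\<forall>m<n. evn X s f (m # xs) > 1)))"

declare evn.simps(7) [simp del]

lemma sum_unique_eq_Suc_iff: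
  assumes "\<And>m n. Q m \<Longrightarrow> Q n \<Longrightarrow> m = (n :: nat)"
  shows "(\<Sum>m<s. Suc m * of_bool (Q m)) = Suc n \<longleftrightarrow> n < s \<and> Q n"
proof (cases "\<exists>m<s. Q m")
  case True
  then obtain m where m: "m < s" "Q m" by blast
  then have Q: "Q i \<longleftrightarrow> i = m" for i
    using assms by blast
  have "(\<Sum>i<s. Suc i * of_bool (Q i)) = (\<Sum>i<s. if i = m then Suc m else 0)"
    unfolding Q by (intro sum.cong refl) simp
  also have "\<dots> = Suc m" using m(1) by simp
  finally show ?thesis using m(1) by (auto simp: Q)
next
  case False
  then have "(\<Sum>i<s. Suc i * of_bool (Q i)) = 0" by (intro sum.neutral) simp
  then show ?thesis using False by auto
qed

lemma evn_Mu_iff: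
  "evn X s (Mu f) xs = Suc n \<longleftrightarrow>
    n < s \<and> evn X s f (n # xs) = 1 \<and> (\<forall>m<n. evn X s f (m # xs) > 1)"
  unfolding evn.simps
proof (rule sum_unique_eq_Suc_iff)
  fix m n
  assume "evn X s f (m # xs) = 1 \<and> (\<forall>l<m. evn X s f (l # xs) > 1)"
    and "evn X s f (n # xs) = 1 \<and> (\<forall>l<n. evn X s f (l # xs) > 1)"
  \<comment> \<open>If m < n, the value at m would be both 1 and greater than 1.\<close>
  then have "\<not> m < n" "\<not> n < m" by force+
  then show "m = n" by simp
qed

lemma evn_Comp_iff:
  "evn X s (Comp f gs) xs = Suc z \<longleftrightarrow>
    (\<exists>ys. list_all2 (\<lambda>g y. evn X s g xs = Suc y) gs ys \<and> evn X s f ys = Suc z)"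
proof -
  let ?ys = "map (\<lambda>g. evn X s g xs - 1) gs"
  have all: "list_all2 (\<lambda>g y. evn X s g xs = Suc y) gs ys \<longleftrightarrow>
      (\<forall>g\<in>set gs. evn X s g xs \<noteq> 0) \<and> ys = ?ys" for ys
  proof (induction gs arbitrary: ys)
    case (Cons g gs)
    then show ?case by (cases ys) auto
  qed simp
  show ?thesis unfolding all by auto
qed

lemma evn_PrimRec_Nil: "evn X s (PrimRec f g) [] = 0"
  by simp

lemma evn_PrimRec_0: "evn X s (PrimRec f g) (0 # xs) = evn X s f xs"
  by simp

lemma evn_PrimRec_Suc_iff:
  "evn X s (PrimRec f g) (Suc n # xs) = Suc y \<longleftrightarrow>
    (\<exists>r. evn X s (PrimRec f g) (n # xs) = Suc r \<and> evn X s g (n # r # xs) = Suc y)"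
  by (cases "evn X s (PrimRec f g) (n # xs)") (auto cong: if_cong)

declare evn.simps(5,6) [simp del]

text \<open>A successful evaluation at stage s has queried X only below s, so it survives a later
  stage and any change of the oracle from s on. This is persistence over stages and the use
  principle in one statement.\<close>

lemma evn_mono:
  assumes "evn X s p xs = Suc y" "s \<le> s'" "\<And>i. i < s \<Longrightarrow> X i = X' i"
  shows "evn X' s' p xs = Suc y"
  using assms(1)
proof (induction p arbitrary: xs y)
  case (Comp f gs)
  then obtain ys where ys: "list_all2 (\<lambda>g y. evn X s g xs = Suc y) gs ys"
    and "evn X s f ys = Suc y"
    unfolding evn_Comp_iff by blast
  moreover have "list_all2 (\<lambda>g y. evn X' s' g xs = Suc y) gs ys"
    using ys by (rule list.rel_mono_strong) (rule Comp.IH(2))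
  ultimately show ?case
    unfolding evn_Comp_iff using Comp.IH(1) by blast
next
  case (PrimRec f g)
  have "evn X s (PrimRec f g) (n # zs) = Suc y \<Longrightarrow> evn X' s' (PrimRec f g) (n # zs) = Suc y"
    for n zs y
  proof (induction n arbitrary: y)
    case 0
    then show ?case using PrimRec.IH(1) by (simp only: evn_PrimRec_0)
  next
    case (Suc n)
    then show ?case
      using PrimRec.IH(2) unfolding evn_PrimRec_Suc_iff by blast
  qed
  with PrimRec.prems show ?case
    by (cases xs) (simp_all add: evn_PrimRec_Nil)
next
  case (Mu f)
  then have y: "y < s" "evn X s f (y # xs) = Suc 0" "\<And>m. m < y \<Longrightarrow> evn X s f (m # xs) > 1"
    by (simp_all add: evn_Mu_iff)
  have "evn X' s' f (m # xs) > 1" if "m < y" for m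
    using Mu.IH y(3)[OF that] by (metis One_nat_def Suc_lessE)
  then show ?case
    using Mu.IH[OF y(2)] y(1) assms(2) by (simp add: evn_Mu_iff)
next
  case Query
  then show ?case using assms(2,3) by (simp add: of_bool_def split: if_splits)
qed simp_all

lemma evn_imp_oeval: "evn X s p xs = Suc y \<Longrightarrow> oeval X p xs y"
proof (induction p arbitrary: xs y)
  case (Comp f gs)
  then obtain ys where ys: "list_all2 (\<lambda>g y. evn X s g xs = Suc y) gs ys"
    and y: "evn X s f ys = Suc y"
    unfolding evn_Comp_iff by blast
  have "list_all2 (\<lambda>g y. oeval X g xs y) gs ys"
    using ys by (rule list.rel_mono_strong) (rule Comp.IH(2))
  then show ?case using Comp.IH(1)[OF y] by (rule oeval_Comp)
next
  case (PrimRec f g)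
  have "evn X s (PrimRec f g) (n # zs) = Suc y \<Longrightarrow> oeval X (PrimRec f g) (n # zs) y" for n zs y
  proof (induction n arbitrary: y)
    case 0
    then show ?case using PrimRec.IH(1) by (simp add: evn_PrimRec_0 oeval_PrimRec_0)
  next
    case (Suc n)
    then show ?case
      using PrimRec.IH(2) oeval_PrimRec_Suc unfolding evn_PrimRec_Suc_iff by blast
  qed
  with PrimRec.prems show ?case
    by (cases xs) (simp_all add: evn_PrimRec_Nil)
next
  case (Mu f)
  then have y: "evn X s f (y # xs) = Suc 0" "\<And>m. m < y \<Longrightarrow> evn X s f (m # xs) > 1"
    by (simp_all add: evn_Mu_iff)
  have "\<exists>k. oeval X f (m # xs) (Suc k)" if "m < y" for m
  proof -
    have "evn X s f (m # xs) > Suc 0" using y(2)[OF that] by simp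
    then obtain k where "evn X s f (m # xs) = Suc (Suc k)"
      by (auto dest!: less_imp_Suc_add)
    then show ?thesis using Mu.IH by blast
  qed
  then show ?case
    using oeval_Mu[OF Mu.IH[OF y(1)]] by simp
next
  case Succ
  then show ?case by (auto simp: length_Suc_conv oeval_Succ split: if_splits)
next
  case Query
  then obtain x where "xs = [x]" "y = (if X x then 1 else 0)"
    by (auto simp: length_Suc_conv split: if_splits)
  then show ?case using oeval_Query by metis
next
  case Zero
  then show ?case by (simp add: oeval_Zero)
next
  case (Proj i)
  then have "i < length xs" "y = xs ! i" by (simp_all split: if_splits)
  then show ?case by (simp add: oeval_Proj)
qed

text \<open>Finitely many subcomputations all succeed at the maximum of their stages. This serves
  the tuple under \<open>Comp\<close> and the values preceding the result of
  \<open>Mu\<close>.\<close>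

lemma evn_common_stage:
  assumes "\<And>i. i < n \<Longrightarrow> \<exists>s. evn X s (p i) (zs i) = Suc (y i)"
  shows "\<exists>s. \<forall>i<(n::nat). evn X s (p i) (zs i) = Suc (y i)"
proof -
  obtain S where S: "\<And>i. i < n \<Longrightarrow> evn X (S i) (p i) (zs i) = Suc (y i)"
    using assms by metis
  have "evn X (Max (S ` {..<n})) (p i) (zs i) = Suc (y i)" if "i < n" for i
    using evn_mono[OF S[OF that]] that by simp
  then show ?thesis by blast
qed

lemma oeval_imp_evn: "oeval X p xs y \<Longrightarrow> \<exists>s. evn X s p xs = Suc y"
proof (induction rule: oeval.induct)
  case (oeval_Comp xs gs ys f z)
  have len: "length ys = length gs"
    using list_all2_lengthD[OF oeval_Comp.IH(1)] by simp
  have "\<exists>s. evn X s (gs ! i) xs = Suc (ys ! i)" if "i < length gs" for i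
    using list_all2_nthD[OF oeval_Comp.IH(1) that] by blast
  from evn_common_stage[where p = "\<lambda>i. gs ! i" and zs = "\<lambda>_. xs" and y = "\<lambda>i. ys ! i", OF this]
  obtain s where s: "\<forall>i<length gs. evn X s (gs ! i) xs = Suc (ys ! i)" by blast
  obtain s' where s': "evn X s' f ys = Suc z" using oeval_Comp.IH(2) by blast
  have "evn X (max s s') (gs ! i) xs = Suc (ys ! i)" if "i < length gs" for i
    by (rule evn_mono[OF s[rule_format, OF that]]) simp_all
  then have "list_all2 (\<lambda>g y. evn X (max s s') g xs = Suc y) gs ys"
    by (simp add: list_all2_conv_all_nth len)
  moreover have "evn X (max s s') f ys = Suc z"
    using evn_mono[OF s', of "max s s'" X] by simp
  ultimately show ?case unfolding evn_Comp_iff by blast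
next
  case (oeval_PrimRec_0 f xs y g)
  then show ?case by (simp add: evn_PrimRec_0)
next
  case (oeval_PrimRec_Suc f g n xs r y)
  then obtain s s' where
    s: "evn X s (PrimRec f g) (n # xs) = Suc r" "evn X s' g (n # r # xs) = Suc y"
    by blast
  have "evn X (max s s') (PrimRec f g) (n # xs) = Suc r"
    using evn_mono[OF s(1), of "max s s'" X] by simp
  moreover have "evn X (max s s') g (n # r # xs) = Suc y"
    using evn_mono[OF s(2), of "max s s'" X] by simp
  ultimately show ?case unfolding evn_PrimRec_Suc_iff by blast
next
  case (oeval_Mu f n xs)
  obtain s where s: "evn X s f (n # xs) = Suc 0" using oeval_Mu.IH(1) by blast
  obtain k where k: "\<And>m. m < n \<Longrightarrow> \<exists>s. evn X s f (m # xs) = Suc (Suc (k m))"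
    using oeval_Mu.IH(2) by metis
  from evn_common_stage[where p = "\<lambda>_. f" and zs = "\<lambda>m. m # xs" and y = "\<lambda>m. Suc (k m)", OF k]
  obtain s' where s': "\<forall>m<n. evn X s' f (m # xs) = Suc (Suc (k m))" by blast
  \<comment> \<open>\<open>Suc n\<close> enters because the result n of the search must lie below
    the stage.\<close>
  define t where "t = max (Suc n) (max s s')"
  have "evn X t f (m # xs) = Suc (Suc (k m))" if "m < n" for m
    using evn_mono[OF s'[rule_format, OF that], of t X] by (simp add: t_def)
  moreover have "evn X t f (n # xs) = 1"
    using evn_mono[OF s, of t X] by (simp add: t_def)
  ultimately have "evn X t (Mu f) xs = Suc n"
    by (simp add: evn_Mu_iff t_def)
  then show ?case by blast
next
  case (oeval_Query x)
  then show ?case by (intro exI[of _ "Suc x"]) simp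
qed simp_all

lemma oeval_iff_evn: "oeval X p xs y \<longleftrightarrow> (\<exists>s. evn X s p xs = Suc y)"
  using evn_imp_oeval oeval_imp_evn by blast

lemma oeval_deterministic: "oeval X p xs y \<Longrightarrow> oeval X p xs z \<Longrightarrow> y = z"
proof -
  assume "oeval X p xs y" "oeval X p xs z"
  then obtain s t where s: "evn X s p xs = Suc y" and t: "evn X t p xs = Suc z"
    unfolding oeval_iff_evn by blast
  have "evn X (max s t) p xs = Suc y" "evn X (max s t) p xs = Suc z"
    using evn_mono[OF s, of "max s t" X] evn_mono[OF t, of "max s t" X] by simp_all
  then show "y = z" by simp
qed

text \<open>Bounded evaluation with a finite oracle, given by its code, is itself computable, so
  averages over all finite oracles will be too. The program p is fixed and the induction runs over
  its structure, for all k at once because subprograms act on tuples of other lengths.\<close>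

lemma ocomputable_evn:
  "ocomputable (Suc (Suc k)) (\<lambda>X ys. evn (bit (hd (tl ys))) (hd ys) p (tl (tl ys)))"
proof (induction p arbitrary: k)
  case Zero
  show ?case unfolding evn.simps by (intro ocomp)
next
  case Succ
  \<comment> \<open>The length of the input is fixed by k, so the length test in \<open>evn\<close>
    becomes a case distinction outside the program.\<close>
  have "ocomputable (Suc (Suc k)) (\<lambda>X ys. if k = 1 then Suc (Suc (hd (tl (tl ys)))) else 0)"
  proof (cases "k = 1")
    case True
    show ?thesis unfolding True One_nat_def by (intro ocomp)
  next
    case False
    then show ?thesis by (simp add: ocomputable_const)
  qed
  then show ?case by (rule ocomputable_cong) auto
next
  case (Proj i)
  have "ocomputable (Suc (Suc k)) (\<lambda>X ys. if i < k then Suc (tl (tl ys) ! i) else 0)"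
    by (cases "i < k") (simp_all add: ocomputable_const ocomputable_Suc ocomputable_nth[OF ocomputable_list_tl2])
  then show ?case by (rule ocomputable_cong) auto
next
  case Query
  have "ocomputable (Suc (Suc k)) (\<lambda>X ys. if k = 1 then if hd (tl (tl ys)) < hd ys
      then Suc (of_bool (bit (hd (tl ys)) (hd (tl (tl ys))))) else 0 else 0)"
  proof (cases "k = 1")
    case True
    show ?thesis unfolding True One_nat_def by (intro ocomp)
  qed (simp add: ocomputable_const)
  then show ?case by (rule ocomputable_cong) auto
next
  case (Comp f gs)
  let ?h = "\<lambda>g ys. evn (bit (hd (tl ys))) (hd ys) g (tl (tl ys))"
  have "ocomputable_list (Suc (Suc k)) (Suc (Suc (length gs)))
      (\<lambda>X ys. hd ys # hd (tl ys) # map (\<lambda>g. ?h g ys - 1) gs)"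
    by (intro ocomp ocomputable_list_map Comp.IH(2))
  from ocomputable_subst[OF this Comp.IH(1)]
  have f: "ocomputable (Suc (Suc k))
      (\<lambda>X ys. evn (bit (hd (tl ys))) (hd ys) f (map (\<lambda>g. ?h g ys - 1) gs))" by simp
  show ?case
    unfolding evn.simps by (intro ocomp odecidable_ball_set Comp.IH(2) f)
next
  case (PrimRec f g)
  show ?case
  proof (cases k)
    case (Suc k')
    have "ocomputable_list (Suc (Suc k)) (Suc (Suc k')) (\<lambda>X ys. hd ys # hd (tl ys) # tl (tl (tl ys)))"
      unfolding Suc by (intro ocomp)
    from ocomputable_subst[OF this PrimRec.IH(1)]
    have f: "ocomputable (Suc (Suc k))
      (\<lambda>X ys. evn (bit (hd (tl ys))) (hd ys) f (tl (tl (tl ys))))" by simp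
    have "ocomputable_list (Suc (Suc (Suc (Suc k)))) (Suc (Suc (Suc (Suc k'))))
      (\<lambda>X ys. hd (tl (tl ys)) # hd (tl (tl (tl ys))) # hd ys # (hd (tl ys) - 1) #
         tl (tl (tl (tl (tl ys)))))"
      unfolding Suc by (intro ocomp)
    from ocomputable_subst[OF this PrimRec.IH(2)]
    have g: "ocomputable (Suc (Suc (Suc (Suc k))))
      (\<lambda>X ys. evn (bit (hd (tl (tl (tl ys))))) (hd (tl (tl ys))) g (hd ys # (hd (tl ys) - 1) #
         tl (tl (tl (tl (tl ys))))))" by simp
    have "ocomputable (Suc (Suc k)) (\<lambda>X ys.
       rec_nat (evn (bit (hd (tl ys))) (hd ys) f (tl (tl (tl ys))))
       (\<lambda>i r. if r = 0 then 0 else evn (bit (hd (tl ys))) (hd ys) g (i # (r - 1) # tl (tl (tl ys))))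
       (hd (tl (tl ys))))"
      unfolding Suc by (intro ocomp f[unfolded Suc] g[unfolded Suc])
    then show ?thesis
      by (rule ocomputable_cong) (simp add: Suc evn.simps(6))
  next
    case 0
    show ?thesis
      by (rule ocomputable_cong[OF ocomputable_const[of _ 0]])
        (auto simp: 0 length_Suc_conv evn_PrimRec_Nil)
  qed
next
  case (Mu f)
  have "ocomputable_list (Suc (Suc (Suc k))) (Suc (Suc (Suc k)))
      (\<lambda>X ys. hd (tl ys) # hd (tl (tl ys)) # hd ys # tl (tl (tl ys)))"
    by (intro ocomp)
  from ocomputable_subst[OF this Mu.IH]
  have 1: "ocomputable (Suc (Suc (Suc k))) (\<lambda>X ys. evn (bit (hd (tl (tl ys)))) (hd (tl ys)) f
      (hd ys # tl (tl (tl ys))))" by simp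
  have "ocomputable_list (Suc (Suc (Suc (Suc k)))) (Suc (Suc (Suc k)))
      (\<lambda>X ys. hd (tl (tl ys)) # hd (tl (tl (tl ys))) # hd ys # tl (tl (tl (tl ys))))"
    by (intro ocomp)
  from ocomputable_subst[OF this Mu.IH]
  have 2: "ocomputable (Suc (Suc (Suc (Suc k)))) (\<lambda>X ys. evn (bit (hd (tl (tl (tl ys)))))
      (hd (tl (tl ys))) f (hd ys # tl (tl (tl (tl ys)))))" by simp
  show ?case unfolding evn.simps by (intro ocomp 1 2)
qed

section \<open>Machines\<close>

definition str_decode :: "nat \<Rightarrow> str" where
  "str_decode = inv str_code"

lemma str_code_decode [simp]: "str_code (str_decode n) = n"
  unfolding str_decode_def by (simp add: surj_f_inv_f bij_is_surj bij_str_code)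

lemma str_decode_code [simp]: "str_decode (str_code \<sigma>) = \<sigma>"
  unfolding str_decode_def by (simp add: bij_is_inj bij_str_code)

lemma str_code_eq_iff [simp]: "str_code \<sigma> = str_code \<tau> \<longleftrightarrow> \<sigma> = \<tau>"
  by (metis str_decode_code)

lemma length_str_decode_eq:
  assumes "2 ^ l \<le> Suc c" "Suc c < 2 ^ Suc l"
  shows "length (str_decode c) = l"
proof -
  have *: "2 ^ length (str_decode c) \<le> Suc c" "Suc c < 2 ^ Suc (length (str_decode c))"
    using str_code_range[of "str_decode c"] by simp_all
  have "(2::nat) ^ l < 2 ^ Suc (length (str_decode c))" "(2::nat) ^ length (str_decode c) < 2 ^ Suc l"
    using assms * by linarith+
  then show ?thesis by (simp add: power_strict_increasing_iff del: power_Suc)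
qed

text \<open>Since \<open>2 ^ l \<le> Suc c < 2 ^ Suc l\<close> for the length l, the indices counted
  are exactly those below l. The bounded sum puts the length into a form that \<open>ocomp\<close>
  handles.\<close>

lemma length_str_decode_sum:
  "length (str_decode c) = (\<Sum>i<Suc c. of_bool (2 ^ Suc i \<le> Suc c))"
proof -
  let ?l = "length (str_decode c)"
  have *: "2 ^ ?l \<le> Suc c" "Suc c < 2 ^ Suc ?l"
    using str_code_range[of "str_decode c"] by simp_all
  have iff: "2 ^ Suc i \<le> Suc c \<longleftrightarrow> i < ?l" for i
  proof
    assume "i < ?l"
    then have "(2::nat) ^ Suc i \<le> 2 ^ ?l" by (intro power_increasing) auto
    with * show "2 ^ Suc i \<le> Suc c" by linarith
  next
    assume "2 ^ Suc i \<le> Suc c"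
    with * have "(2::nat) ^ Suc i < 2 ^ Suc ?l" by linarith
    then show "i < ?l" by (simp add: power_strict_increasing_iff del: power_Suc)
  qed
  have "?l < 2 ^ ?l" by (rule less_exp)
  with * have "?l < Suc c" by linarith
  then have "{..<Suc c} \<inter> {i. i < ?l} = {..<?l}" by auto
  then show ?thesis unfolding iff by (simp add: sum_of_bool_eq del: sum.lessThan_Suc)
qed

lemma ocomputable_length_str_decode [ocomp]:
  assumes "ocomputable k f"
  shows "ocomputable k (\<lambda>X xs. length (str_decode (f X xs)))"
proof -
  have "ocomputable (Suc k) (\<lambda>X ys. f X (tl ys))"
    by (rule ocomputable_subst[OF _ assms]) (intro ocomp)
  then show ?thesis unfolding length_str_decode_sum by (intro ocomp assms)
qed

section \<open>Complexity bounds from prefix-free machines\<close>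

lemma KO_le: "U X \<tau> = Some \<sigma> \<Longrightarrow> KO U X \<sigma> \<le> length \<tau>"
  unfolding KO_def by (rule Least_le) blast

text \<open>A machine is specified by a decidable relation: \<open>Q X s x\<close> makes the string
  with code x a description of \<open>g X s\<close>. The machine searches for s by
  \<open>Mu\<close>, which makes its domain semidecidable only; uniqueness of s makes its output
  well defined.\<close>

lemma universal_machine_simulates:
  fixes Q :: "cantor \<Rightarrow> nat \<Rightarrow> nat \<Rightarrow> bool" and g :: "cantor \<Rightarrow> nat \<Rightarrow> nat"
  assumes U: "universal_machine U"
    and Q: "odecidable (Suc (Suc 0)) (\<lambda>X xs. Q X (hd xs) (hd (tl xs)))"
    and g: "ocomputable (Suc 0) (\<lambda>X xs. g X (hd xs))"
    and unique: "\<And>X s s' x. Q X s x \<Longrightarrow> Q X s' x \<Longrightarrow> s = s'"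
    and pf: "\<And>X s s' \<sigma> \<tau>. Q X s (str_code \<sigma>) \<Longrightarrow> Q X s' (str_code \<tau>) \<Longrightarrow> prefix \<sigma> \<tau> \<Longrightarrow> \<sigma> = \<tau>"
  shows "\<exists>\<rho>. \<forall>X s \<sigma>. Q X s (str_code \<sigma>) \<longrightarrow> U X (\<rho> @ \<sigma>) = Some (str_decode (g X s))"
proof -
  \<comment> \<open>\<open>Mu\<close> searches for the value 0, so q has to compute the truth value
    of the negation.\<close>
  have "ocomputable (Suc (Suc 0)) (\<lambda>X xs. of_bool (\<not> Q X (hd xs) (hd (tl xs))))"
    by (intro ocomp Q)
  then obtain q where q: "\<And>X s x. oeval X q [s, x] (of_bool (\<not> Q X s x))"
    unfolding ocomputable_def
    by (metis (no_types, lifting) length_Cons list.sel list.size(3))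
  obtain r where r: "\<And>X s. oeval X r [s] (g X s)"
    using g unfolding ocomputable_def by (metis length_Cons list.sel(1) list.size(3))
  define M where "M = (\<lambda>X \<sigma>. if \<exists>s. Q X s (str_code \<sigma>)
    then Some (str_decode (g X (THE s. Q X s (str_code \<sigma>)))) else None)"
  have M_eq: "M X \<sigma> = Some (str_decode (g X s))" if "Q X s (str_code \<sigma>)" for X s \<sigma>
  proof -
    have "(THE s. Q X s (str_code \<sigma>)) = s"
      using that unique by (intro the_equality)
    then show ?thesis using that unfolding M_def by auto
  qed
  have M_None: "M X \<sigma> = None" if "\<nexists>s. Q X s (str_code \<sigma>)" for X \<sigma>
    unfolding M_def if_not_P[OF that] ..
  have Mu: "oeval X (Mu q) [x] s \<longleftrightarrow> Q X s x" for X x s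
  proof
    assume "oeval X (Mu q) [x] s"
    then have "oeval X q [s, x] 0" by cases auto
    from oeval_deterministic[OF this q] show "Q X s x" by (simp split: if_splits)
  next
    assume Qs: "Q X s x"
    show "oeval X (Mu q) [x] s"
    proof (rule oeval_Mu)
      show "oeval X q [s, x] 0" using q[of X s x] Qs by simp
      \<comment> \<open>By uniqueness every m below s fails \<open>Q\<close>, so q has the positive
        value there that \<open>Mu\<close> requires.\<close>
      have "oeval X q [m, x] (Suc 0)" if "m < s" for m
        using q[of X m x] unique[OF Qs, of m] that by fastforce
      then show "\<forall>m<s. \<exists>k. oeval X q [m, x] (Suc k)" by blast
    qed
  qed
  have "oeval X (Comp r [Mu q]) [x] y \<longleftrightarrow> (\<exists>s. Q X s x \<and> y = g X s)" for X x y
  proof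
    assume "oeval X (Comp r [Mu q]) [x] y"
    then obtain s where "oeval X (Mu q) [x] s" "oeval X r [s] y"
      by cases (auto simp: list_all2_Cons1)
    then show "\<exists>s. Q X s x \<and> y = g X s"
      using Mu oeval_deterministic[OF _ r] by blast
  next
    assume "\<exists>s. Q X s x \<and> y = g X s"
    then obtain s where "Q X s x" "y = g X s" by blast
    then show "oeval X (Comp r [Mu q]) [x] y"
      using Mu r by (intro oeval_Comp[where ys = "[s]"]) auto
  qed
  moreover have "M X \<sigma> = Some \<tau> \<longleftrightarrow> (\<exists>s. Q X s (str_code \<sigma>) \<and> str_code \<tau> = g X s)" for X \<sigma> \<tau>
  proof (cases "\<exists>s. Q X s (str_code \<sigma>)")
    case True
    then obtain s where s: "Q X s (str_code \<sigma>)" by blast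
    have "M X \<sigma> = Some \<tau> \<longleftrightarrow> str_code \<tau> = g X s"
      unfolding M_eq[OF s] by (metis option.inject str_code_decode str_decode_code)
    then show ?thesis using s unique by blast
  qed (use M_None in auto)
  ultimately have "partial_computable M"
    unfolding partial_computable_def by blast
  moreover have "prefix_free (dom (M X))" for X
    unfolding prefix_free_def
  proof (intro ballI impI)
    fix \<sigma> \<tau>
    assume "\<sigma> \<in> dom (M X)" "\<tau> \<in> dom (M X)" and pre: "prefix \<sigma> \<tau>"
    then obtain s s' where "Q X s (str_code \<sigma>)" "Q X s' (str_code \<tau>)"
      using M_None by (metis domIff)
    then show "\<sigma> = \<tau>" using pf pre by blast
  qed
  ultimately have "prefix_free_machine M" by (simp add: prefix_free_machine_def)
  with U obtain \<rho> where "\<And>X \<sigma>. U X (\<rho> @ \<sigma>) = M X \<sigma>"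
    unfolding universal_machine_def by blast
  then show ?thesis using M_eq by metis
qed

lemma str_code_unary: "str_code (replicate n False @ [True]) = 2 ^ Suc n"
proof -
  have "Suc (str_code (replicate n False)) = 2 ^ n"
  proof (induction n)
    case (Suc n)
    have "replicate (Suc n) False = replicate n False @ [False]"
      by (simp add: replicate_append_same)
    then show ?case using Suc by (simp only: str_code_snoc) simp
  qed simp
  then show ?thesis by simp
qed

text \<open>The strings consisting of n zeros and a final one form a prefix-free set, and their
  codes are the numbers \<open>2 ^ Suc n\<close>, which makes them recognisable by arithmetic. The
  constant is the length of the simulation prefix plus 1 for the final one.\<close>

lemma universal_machine_unary:
  assumes U: "universal_machine U" and g: "ocomputable (Suc 0) (\<lambda>X xs. g X (hd xs))"
  shows "\<exists>c. \<forall>X n. \<exists>\<tau>. length \<tau> = n + c \<and> U X \<tau> = Some (str_decode (g X n))"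
proof -
  have "\<exists>\<rho>. \<forall>X n \<sigma>. str_code \<sigma> = 2 ^ Suc n \<longrightarrow> U X (\<rho> @ \<sigma>) = Some (str_decode (g X n))"
  proof (rule universal_machine_simulates[OF U _ g])
    show "odecidable (Suc (Suc 0)) (\<lambda>X xs. hd (tl xs) = 2 ^ Suc (hd xs))"
      by (intro ocomp)
    show "s = s'" if "x = 2 ^ Suc s" "x = 2 ^ Suc s'" for s s' x :: nat
      using that by simp
    show "\<sigma> = \<tau>" if "str_code \<sigma> = 2 ^ Suc n" "str_code \<tau> = 2 ^ Suc m" and pre: "prefix \<sigma> \<tau>"
      for n m \<sigma> \<tau>
    proof -
      have eqs: "\<sigma> = replicate n False @ [True]" "\<tau> = replicate m False @ [True]"
        using that(1,2) by (metis str_code_unary str_code_eq_iff)+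
      obtain \<alpha> where "\<tau> = \<sigma> @ \<alpha>" using pre by (auto simp: prefix_def)
      \<comment> \<open>Position n of \<tau> holds the final one of \<sigma>, but the only one in
        \<tau> is at position m.\<close>
      then have "\<tau> ! n" and "n \<le> m"
        using eqs by (simp_all add: nth_append, metis add_Suc_right length_append length_replicate
          le_add1 list.size(3,4) add_le_cancel_right)
      then have "n = m"
        unfolding eqs(2) by (simp add: nth_append split: if_splits)
      then show ?thesis using eqs by simp
    qed
  qed
  then obtain \<rho> where \<rho>: "\<And>X n \<sigma>. str_code \<sigma> = 2 ^ Suc n \<Longrightarrow>
      U X (\<rho> @ \<sigma>) = Some (str_decode (g X n))"
    by blast
  show ?thesis
    using \<rho>[OF str_code_unary]
    by (intro exI[of _ "Suc (length \<rho>)"] allI exI[of _ "\<rho> @ replicate _ False @ [True]"]) simp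
qed

text \<open>A unary description of the code of \<sigma> shows that the minimum in \<open>KO\<close>
  is over a nonempty set.\<close>

lemma KO_attained:
  assumes "universal_machine U"
  obtains \<tau> where "length \<tau> = KO U X \<sigma>" "U X \<tau> = Some \<sigma>"
proof -
  obtain \<tau> where "U X \<tau> = Some (str_decode (str_code \<sigma>))"
    using universal_machine_unary[OF assms, of "\<lambda>X n. n"] ocomputable_hds(1) by blast
  then have "\<exists>\<tau>'. length \<tau>' = length \<tau> \<and> U X \<tau>' = Some \<sigma>" by auto
  from LeastI[where P = "\<lambda>n. \<exists>\<tau>. length \<tau> = n \<and> U X \<tau> = Some \<sigma>", OF this]
  show ?thesis using that unfolding KO_def by blast
qed

text \<open>Writing \<open>x\<close> for the binary fraction given by \<open>\<sigma>\<close>, the string \<open>\<sigma>\<close> stands for the dyadic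
  interval from \<open>str_lo \<sigma> = 1 + x\<close> to \<open>str_hi \<sigma>\<close>; the numerator \<open>str_code \<sigma> + 1\<close> is
  \<open>\<sigma>\<close> with a leading 1, read in binary.\<close>

definition str_lo :: "str \<Rightarrow> real" where
  "str_lo \<sigma> = real (str_code \<sigma> + 1) / 2 ^ length \<sigma>"

definition str_hi :: "str \<Rightarrow> real" where
  "str_hi \<sigma> = real (str_code \<sigma> + 2) / 2 ^ length \<sigma>"

lemma str_lo_less_hi: "str_lo \<sigma> < str_hi \<sigma>"
  unfolding str_lo_def str_hi_def by (simp add: divide_strict_right_mono)

lemma prefix_str_lo_hi:
  assumes "prefix \<sigma> \<tau>"
  shows "str_lo \<sigma> \<le> str_lo \<tau>" "str_hi \<tau> \<le> str_hi \<sigma>"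
proof -
  obtain \<alpha> where \<tau>: "\<tau> = \<sigma> @ \<alpha>" using assms by (auto simp: prefix_def)
  have "2 ^ length \<alpha> \<le> real (str_code \<alpha>) + 1" "real (str_code \<alpha>) + 2 \<le> 2 * 2 ^ length \<alpha>"
  proof -
    have "real (2 ^ length \<alpha>) \<le> real (Suc (str_code \<alpha>))"
      "real (str_code \<alpha> + 2) \<le> real (2 * 2 ^ length \<alpha>)"
      using str_code_range[of \<alpha>] unfolding of_nat_le_iff by simp_all
    then show "2 ^ length \<alpha> \<le> real (str_code \<alpha>) + 1"
      "real (str_code \<alpha>) + 2 \<le> 2 * 2 ^ length \<alpha>" by simp_all
  qed
  then have "2 ^ length \<alpha> * 2 ^ length \<sigma> \<le> (real (str_code \<alpha>) + 1) * 2 ^ length \<sigma>"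
    "(real (str_code \<alpha>) + 2) * 2 ^ length \<sigma> \<le> 2 * 2 ^ length \<alpha> * 2 ^ length \<sigma>"
    by (intro mult_right_mono; simp)+
  then show "str_lo \<sigma> \<le> str_lo \<tau>" "str_hi \<tau> \<le> str_hi \<sigma>"
    unfolding str_lo_def str_hi_def \<tau>
    by (simp_all add: str_code_append power_add divide_simps algebra_simps)
qed


text \<open>A string whose dyadic interval lies between \<open>1 + t s\<close> and \<open>1 + t (s + 1)\<close>, and which is
  the length-lexicographically least such, is made a description of \<open>s\<close>.\<close>

lemma universal_machine_increments:
  fixes T :: "nat \<Rightarrow> nat" and t :: "nat \<Rightarrow> real"
  defines "t \<equiv> \<lambda>s. real (T s) / 4 ^ s"
  assumes U: "universal_machine U" and T: "ocomputable (Suc 0) (\<lambda>X xs. T (hd xs))"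
    and mono: "incseq t" and bound: "\<And>s. t s \<le> 1"
  shows "\<exists>c. \<forall>s. t (Suc s) - t s \<le> 2 ^ c * (1 / 2) ^ K U (str_decode s)"
proof -
  define P where "P s x \<longleftrightarrow>
      1 + t s \<le> str_lo (str_decode x) \<and> str_hi (str_decode x) \<le> 1 + t (Suc s)" for s x
  define Q where "Q s x \<longleftrightarrow> P s x \<and> (\<forall>y<x. \<not> P s y)" for s x
  \<comment> \<open>Clearing denominators turns \<open>P\<close> into inequalities between natural
    numbers, which are decidable.\<close>
  have P_iff: "P s x \<longleftrightarrow>
      (4 ^ s + T s) * 2 ^ length (str_decode x) \<le> Suc x * 4 ^ s \<and>
      Suc (Suc x) * 4 ^ Suc s \<le> (4 ^ Suc s + T (Suc s)) * 2 ^ length (str_decode x)" for s x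
  proof -
    have "1 + t s \<le> str_lo (str_decode x) \<longleftrightarrow>
      real ((4 ^ s + T s) * 2 ^ length (str_decode x)) \<le> real (Suc x * 4 ^ s)"
      unfolding t_def str_lo_def by (simp add: field_simps)
    moreover have "str_hi (str_decode x) \<le> 1 + t (Suc s) \<longleftrightarrow>
      real (Suc (Suc x) * 4 ^ Suc s) \<le> real ((4 ^ Suc s + T (Suc s)) * 2 ^ length (str_decode x))"
      unfolding t_def str_hi_def by (simp add: field_simps)
    ultimately show ?thesis unfolding P_def of_nat_le_iff by blast
  qed
  \<comment> \<open>The gaps belonging to different s share at most an end point, while the interval
    of a string has positive length.\<close>
  have P_unique: "s = s'" if "P s x" "P s' x" for s s' x
  proof -
    have False if "P s x" "P s' x" "s < s'" for s s'
    proof -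
      have "t (Suc s) \<le> t s'" using mono \<open>s < s'\<close> by (simp add: incseqD)
      then show False
        using that(1,2) str_lo_less_hi[of "str_decode x"] unfolding P_def by linarith
    qed
    then show ?thesis using that by (metis linorder_neqE_nat)
  qed
  have "\<exists>\<rho>. \<forall>X s \<sigma>. Q s (str_code \<sigma>) \<longrightarrow> U X (\<rho> @ \<sigma>) = Some (str_decode s)"
  proof (rule universal_machine_simulates[OF U])
    have T': "ocomputable k (\<lambda>X xs. T (f X xs))" if "ocomputable k f" for k f
    proof -
      have "ocomputable_list k (Suc 0) (\<lambda>X xs. [f X xs])" by (intro ocomp that)
      from ocomputable_subst[OF this T] show ?thesis by simp
    qed
    show "odecidable (Suc (Suc 0)) (\<lambda>X xs. Q (hd xs) (hd (tl xs)))"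
      unfolding Q_def P_iff by (intro ocomp T')
    show "ocomputable (Suc 0) (\<lambda>X xs. hd xs)" by (intro ocomp)
    show "s = s'" if "Q s x" "Q s' x" for s s' x
      using that P_unique unfolding Q_def by blast
    show "\<sigma> = \<tau>" if Q: "Q s (str_code \<sigma>)" "Q s' (str_code \<tau>)" and pre: "prefix \<sigma> \<tau>" for s s' \<sigma> \<tau>
    proof -
      \<comment> \<open>The interval of an extension is contained in that of the prefix, so both
        strings fit into the same gap and leastness identifies them.\<close>
      have "P s (str_code \<tau>)"
        using Q prefix_str_lo_hi[OF pre] unfolding Q_def P_def by simp
      then have "s = s'" using Q P_unique unfolding Q_def by blast
      then have "str_code \<sigma> = str_code \<tau>"
        using Q unfolding Q_def by (metis linorder_neqE_nat)
      then show ?thesis by simp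
    qed
  qed
  then obtain \<rho> where \<rho>: "\<And>X s \<sigma>. Q s (str_code \<sigma>) \<Longrightarrow> U X (\<rho> @ \<sigma>) = Some (str_decode s)"
    by blast
  have "t (Suc s) - t s \<le> 2 ^ (length \<rho> + 2) * (1 / 2) ^ K U (str_decode s)" for s
  proof (cases "t (Suc s) - t s > 0")
    case False
    moreover have "0 \<le> 2 ^ (length \<rho> + 2) * (1 / 2 :: real) ^ K U (str_decode s)" by simp
    ultimately show ?thesis by linarith
  next
    case True
    define r where "r = t (Suc s) - t s"
    have ts: "0 \<le> t s" by (simp add: t_def)
    have r: "0 < r" "r \<le> 1"
      using True bound[of "Suc s"] ts unfolding r_def by linarith+
    \<comment> \<open>An interval of length at most half the gap r still fits after its left end is
      rounded up to the grid. Taking l least keeps r within the factor 4 of its length.\<close>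
    define l where "l = (LEAST l. (1 / 2) ^ l \<le> r / 2)"
    have "\<exists>l. (1 / 2) ^ l < r / 2"
      using r(1) by (intro real_arch_pow_inv) auto
    then have l: "(1 / 2) ^ l \<le> r / 2"
      unfolding l_def by (metis (mono_tags, lifting) LeastI less_imp_le)
    have "l \<noteq> 0" using l r(2) by (cases l) auto
    then obtain l' where l': "l = Suc l'" by (cases l) auto
    have "\<not> (1 / 2) ^ l' \<le> r / 2"
      using not_less_Least[of l' "\<lambda>l. (1 / 2) ^ l \<le> r / 2"] l' unfolding l_def by auto
    then have l_ge: "r \<le> 4 * (1 / 2) ^ l" unfolding l' by simp
    have rl: "2 \<le> r * 2 ^ l" using l by (simp add: power_one_over field_simps)
    \<comment> \<open>Rounding up costs less than one grid step, and the gap spans at least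
      two.\<close>
    define m where "m = nat \<lceil>(1 + t s) * 2 ^ l\<rceil>"
    have m_lo: "(1 + t s) * 2 ^ l \<le> m"
      unfolding m_def by (rule real_nat_ceiling_ge)
    have "0 \<le> (1 + t s) * 2 ^ l" using ts by simp
    then have "real m < (1 + t s) * 2 ^ l + 1"
      unfolding m_def by linarith
    then have m_hi: "real m + 1 \<le> (1 + t (Suc s)) * 2 ^ l"
      using rl by (simp add: r_def algebra_simps)
    have "1 * 2 ^ l \<le> (1 + t s) * 2 ^ l"
      by (rule mult_right_mono) (use ts in auto)
    with m_lo have "2 ^ l \<le> real m" by linarith
    then have m_ge: "2 ^ l \<le> m" by simp
    have "(1 + t (Suc s)) * 2 ^ l \<le> 2 * 2 ^ l"
      by (rule mult_right_mono) (use bound[of "Suc s"] in auto)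
    with m_hi have "real m < 2 * 2 ^ l" by linarith
    then have "real m < real (2 ^ Suc l)" by simp
    then have m_less: "m < 2 ^ Suc l" by (simp only: of_nat_less_iff)
    have "0 < m" using m_ge by (simp add: order_less_le_trans[OF _ m_ge])
    \<comment> \<open>The numerator in \<open>str_lo\<close> is the code plus 1, so m belongs to the
      code m - 1.\<close>
    then obtain x where x: "m = Suc x" by (cases m) auto
    have len: "length (str_decode x) = l"
      using m_ge m_less unfolding x by (rule length_str_decode_eq)
    have "P s x"
      unfolding P_def str_lo_def str_hi_def len using m_lo m_hi unfolding x
      by (simp add: field_simps)
    \<comment> \<open>The least code satisfying \<open>P s\<close> satisfies \<open>Q s\<close>;
      being at most x, it belongs to a string of length at most l.\<close>
    define y where "y = (LEAST y. P s y)"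
    have y: "P s y" "y \<le> x" and "\<And>z. z < y \<Longrightarrow> \<not> P s z"
      unfolding y_def using \<open>P s x\<close> by (auto intro: LeastI Least_le dest: not_less_Least)
    then have "Q s (str_code (str_decode y))" unfolding Q_def by simp
    from KO_le[of U empty_oracle, OF \<rho>[OF this]] have "K U (str_decode s) \<le> length \<rho> + length (str_decode y)"
      by simp
    moreover have "length (str_decode y) \<le> l"
    proof -
      have "2 ^ length (str_decode y) \<le> Suc y" "Suc x < 2 ^ Suc l"
        using str_code_range[of "str_decode y"] m_less x by simp_all
      then have "(2::nat) ^ length (str_decode y) < 2 ^ Suc l" using y(2) by linarith
      then show ?thesis by (simp add: power_strict_increasing_iff del: power_Suc)
    qed
    ultimately have "K U (str_decode s) \<le> length \<rho> + l" by linarith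
    then have "(1 / 2 :: real) ^ (length \<rho> + l) \<le> (1 / 2) ^ K U (str_decode s)"
      by (intro power_decreasing) auto
    then have "2 ^ length \<rho> * (1 / 2 :: real) ^ (length \<rho> + l) \<le>
        2 ^ length \<rho> * (1 / 2) ^ K U (str_decode s)"
      by (intro mult_left_mono) auto
    moreover have "2 ^ length \<rho> * (1 / 2 :: real) ^ (length \<rho> + l) = (1 / 2) ^ l"
      by (simp add: power_add power_one_over)
    ultimately have "r \<le> 4 * (2 ^ length \<rho> * (1 / 2) ^ K U (str_decode s))"
      using l_ge by linarith
    then show ?thesis unfolding r_def[symmetric] by (simp add: power_add mult.assoc)
  qed
  then show ?thesis by blast
qed

section \<open>Random reals\<close>

definition coin :: "cantor measure" where
  "coin = PiM UNIV (\<lambda>_. measure_pmf (bernoulli_pmf (1 / 2)))"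

interpretation coin_factors: product_prob_space "\<lambda>_. measure_pmf (bernoulli_pmf (1 / 2))" UNIV
  by unfold_locales

interpretation coin: prob_space coin
  unfolding coin_def by (rule prob_space_PiM) (rule prob_space_measure_pmf)

lemma space_coin [simp]: "space coin = UNIV"
  unfolding coin_def space_PiM by (simp add: PiE_UNIV_domain)

lemma coin_cylinder:
  shows "{A. \<forall>i<n. A i = a i} \<in> sets coin"
    and "measure coin {A. \<forall>i<n. A i = a i} = (1 / 2) ^ n"
proof -
  let ?M = "\<lambda>_ :: nat. measure_pmf (bernoulli_pmf (1 / 2))"
  have "space (PiM UNIV ?M) = UNIV"
    using space_coin unfolding coin_def .
  then have eq: "{A. \<forall>i<n. A i = a i} = {A \<in> space (PiM UNIV ?M). \<forall>i\<in>{..<n}. A i \<in> {a i}}"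
    by (simp only: Ball_def lessThan_iff singleton_iff UNIV_I simp_thms)
  have emb: "{A. \<forall>i<n. A i = a i} = prod_emb UNIV ?M {..<n} (Pi\<^sub>E {..<n} (\<lambda>i. {a i}))"
    unfolding eq by (rule set_eqI) (simp add: prod_emb_def PiE_iff space_PiM)
  show "{A. \<forall>i<n. A i = a i} \<in> sets coin"
    unfolding emb coin_def by (rule sets_PiM_I) simp_all
  have half: "measure (measure_pmf (bernoulli_pmf (1 / 2))) {b} = 1 / 2" for b
    by (cases b) (simp_all add: measure_pmf_single)
  have "measure (PiM UNIV ?M) (prod_emb UNIV ?M {..<n} (Pi\<^sub>E {..<n} (\<lambda>i. {a i}))) =
      (\<Prod>i<n. measure (?M i) {a i})"
    by (rule coin_factors.measure_PiM_emb) simp_all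
  then show "measure coin {A. \<forall>i<n. A i = a i} = (1 / 2) ^ n"
    unfolding emb coin_def half by simp
qed

lemma coin_cylinder_str:
  shows "{A. map A [0..<length \<sigma>] = \<sigma>} \<in> sets coin"
    and "measure coin {A. map A [0..<length \<sigma>] = \<sigma>} = (1 / 2) ^ length \<sigma>"
proof -
  have "map A [0..<length \<sigma>] = \<sigma> \<longleftrightarrow> (\<forall>i<length \<sigma>. A i = \<sigma> ! i)" for A
    unfolding list_eq_iff_nth_eq by simp
  then have eq: "{A. map A [0..<length \<sigma>] = \<sigma>} = {A. \<forall>i<length \<sigma>. A i = \<sigma> ! i}"
    by (rule Collect_cong)
  show "{A. map A [0..<length \<sigma>] = \<sigma>} \<in> sets coin"
    unfolding eq by (rule coin_cylinder(1))
  show "measure coin {A. map A [0..<length \<sigma>] = \<sigma>} = (1 / 2) ^ length \<sigma>"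
    unfolding eq by (rule coin_cylinder(2))
qed

text \<open>Such an event is a disjoint union of cylinders of measure \<open>(1 / 2) ^ n\<close>,
  indexed by the numbers below \<open>2 ^ n\<close> read as bit patterns. Its probability thus
  becomes a finite count.\<close>

lemma coin_finitely_determined:
  assumes Q: "\<And>A B. (\<And>i. i < n \<Longrightarrow> A i = B i) \<Longrightarrow> Q A \<longleftrightarrow> Q B"
  shows "{A. Q A} \<in> sets coin"
    and "measure coin {A. Q A} = (\<Sum>a<(2::nat) ^ n. of_bool (Q (bit a))) / 2 ^ n"
proof -
  let ?I = "{..<2 ^ n} \<inter> {a :: nat. Q (bit a)}"
  let ?C = "\<lambda>a :: nat. {A. \<forall>i<n. A i = bit a i}"
  have "\<exists>a<(2 :: nat) ^ n. \<forall>i<n. A i = bit a i" for A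
  proof -
    let ?a = "horner_sum of_bool 2 (map A [0..<n]) :: nat"
    have "?a < 2 ^ n"
      using horner_sum_of_bool_2_less[of "map A [0..<n]", where 'a = nat] by simp
    moreover have "A i = bit ?a i" if "i < n" for i
      using that by (simp add: bit_horner_sum_bit_iff)
    ultimately show ?thesis by (intro exI[of _ ?a]) simp
  qed
  then have cover: "\<exists>a. a < 2 ^ n \<and> A \<in> ?C a" for A by blast
  have Q_iff: "Q A \<longleftrightarrow> Q (bit a)" if "A \<in> ?C a" for A and a :: nat
    using that by (intro Q) blast
  have eq: "{A. Q A} = (\<Union>a\<in>?I. ?C a)"
  proof (rule set_eqI)
    fix A
    obtain a where "a < 2 ^ n" "A \<in> ?C a" using cover by blast
    then show "A \<in> {A. Q A} \<longleftrightarrow> A \<in> (\<Union>a\<in>?I. ?C a)"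
      using Q_iff by blast
  qed
  have unique: "a = b" if "a < 2 ^ n" "b < 2 ^ n" "\<And>i. i < n \<Longrightarrow> bit a i = bit b i" for a b :: nat
  proof -
    have "take_bit n a = take_bit n b"
      by (rule bit_eqI) (use that(3) in \<open>auto simp: bit_take_bit_iff\<close>)
    then show ?thesis using that(1,2) by (simp add: take_bit_nat_eq_self)
  qed
  have disj: "disjoint_family_on ?C ?I"
    unfolding disjoint_family_on_def
  proof (intro ballI impI equals0I)
    fix a b A
    assume *: "a \<in> ?I" "b \<in> ?I" "a \<noteq> b" "A \<in> ?C a \<inter> ?C b"
    then have "bit a i = bit b i" if "i < n" for i
      using that by (metis (mono_tags, lifting) IntE mem_Collect_eq)
    then have "a = b" using * by (intro unique) simp_all
    then show False using *(3) by simp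
  qed
  show "{A. Q A} \<in> sets coin"
    unfolding eq by (intro sets.finite_UN coin_cylinder) auto
  have "measure coin {A. Q A} = (\<Sum>a\<in>?I. measure coin (?C a))"
    unfolding eq by (intro coin.finite_measure_finite_Union disj) (auto intro: coin_cylinder)
  also have "\<dots> = card ?I * (1 / 2) ^ n"
    by (simp add: coin_cylinder)
  finally show "measure coin {A. Q A} = (\<Sum>a<(2::nat) ^ n. of_bool (Q (bit a))) / 2 ^ n"
    by (simp add: sum_of_bool_eq power_one_over field_simps)
qed

text \<open>The cylinders of a prefix-free set are disjoint events with the summands as
  probabilities.\<close>

lemma kraft_inequality:
  assumes "finite F" "prefix_free F"
  shows "(\<Sum>\<sigma>\<in>F. (1 / 2) ^ length \<sigma>) \<le> (1 :: real)"
proof -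
  let ?C = "\<lambda>\<sigma>. {A. map A [0..<length \<sigma>] = \<sigma>}"
  have pre: "prefix \<sigma> \<tau>"
    if "map A [0..<length \<sigma>] = \<sigma>" "map A [0..<length \<tau>] = \<tau>" "length \<sigma> \<le> length \<tau>" for A \<sigma> \<tau>
  proof -
    have "take (length \<sigma>) (map A [0..<length \<tau>]) = map A [0..<length \<sigma>]"
      using that(3) by (simp add: take_map)
    then show ?thesis using that by (metis take_is_prefix)
  qed
  have "\<sigma> = \<tau>" if "\<sigma> \<in> F" "\<tau> \<in> F" "A \<in> ?C \<sigma>" "A \<in> ?C \<tau>" for \<sigma> \<tau> A
    using that pre[of A \<sigma> \<tau>] pre[of A \<tau> \<sigma>] assms(2) unfolding prefix_free_def
    by (metis (mono_tags, lifting) mem_Collect_eq nle_le)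
  then have "disjoint_family_on ?C F"
    unfolding disjoint_family_on_def by blast
  then have "measure coin (\<Union>\<sigma>\<in>F. ?C \<sigma>) = (\<Sum>\<sigma>\<in>F. measure coin (?C \<sigma>))"
    by (intro coin.finite_measure_finite_Union assms(1)) (auto intro: coin_cylinder_str)
  then show ?thesis
    using coin.prob_le_1[of "\<Union>\<sigma>\<in>F. ?C \<sigma>"] by (simp add: coin_cylinder_str)
qed

text \<open>The event is the intersection of the decreasing tail unions. Each of these contains some
  \<open>E n\<close> of probability at least c, and continuity from above carries the bound to the
  limit.\<close>

lemma (in prob_space) prob_infinitely_often_ge:
  assumes E: "\<And>n. E n \<in> events" and inf: "infinite {n :: nat. c \<le> prob (E n)}"
  shows "{x \<in> space M. infinite {n. x \<in> E n}} \<in> events"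
    and "c \<le> prob {x \<in> space M. infinite {n. x \<in> E n}}"
proof -
  define B where "B N = (\<Union>n\<in>{N..}. E n)" for N
  have BN: "B N \<in> events" for N
    unfolding B_def
  proof (rule sets.countable_UN'')
    show "countable {N..}" by (rule countableI_type)
  qed (rule E)
  have B: "range B \<subseteq> events" using BN by (rule image_subsetI)
  have eq: "{x \<in> space M. infinite {n. x \<in> E n}} = (\<Inter>N. B N)"
  proof (rule set_eqI)
    fix x
    have "x \<in> space M" if "x \<in> E n" for n
      using subsetD[OF sets.sets_into_space[OF E] that] .
    moreover have "infinite {n. x \<in> E n} \<longleftrightarrow> (\<forall>N. x \<in> B N)"
      unfolding B_def infinite_nat_iff_unbounded_le by (simp add: Bex_def)
    moreover have "\<exists>n. x \<in> E n" if "x \<in> B 0"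
      using that by (simp add: B_def)
    ultimately show "x \<in> {x \<in> space M. infinite {n. x \<in> E n}} \<longleftrightarrow> x \<in> (\<Inter>N. B N)"
      unfolding mem_Collect_eq INT_iff by (metis UNIV_I)
  qed
  show "{x \<in> space M. infinite {n. x \<in> E n}} \<in> events"
    unfolding eq using B by (rule sets.countable_INT) simp
  have "decseq B"
    unfolding B_def decseq_def by (intro allI impI UN_mono) simp_all
  have cB: "c \<le> prob (B N)" for N
  proof -
    obtain n where n: "n \<ge> N" "c \<le> prob (E n)"
      using inf unfolding infinite_nat_iff_unbounded_le by blast
    have "prob (E n) \<le> prob (B N)"
      using BN n(1) by (intro finite_measure_mono UN_upper) (simp_all add: B_def UN_upper)
    with n(2) show ?thesis by linarith
  qed
  show "c \<le> prob {x \<in> space M. infinite {n. x \<in> E n}}"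
    unfolding eq
    by (rule LIMSEQ_le_const[OF finite_Lim_measure_decseq[OF B \<open>decseq B\<close>]]) (simp add: cB)
qed

text \<open>Row \<open>s\<close> contributes to \<open>t s\<close> only in the columns below \<open>s\<close>, so the limits of the columns
  \<open>y \<ge> N\<close> add up to at most \<open>lim t - t N\<close>.\<close>

lemma infinite_columns_le_increments:
  fixes w :: "nat \<Rightarrow> nat \<Rightarrow> real"
  defines "t \<equiv> \<lambda>s. \<Sum>y<s. w s y"
  assumes nonneg: "\<And>s y. 0 \<le> w s y" and mono: "\<And>s s' y. s \<le> s' \<Longrightarrow> w s y \<le> w s' y"
    and bound: "\<And>s. t s \<le> b"
  shows "infinite {y. \<forall>s. w s y \<le> t (Suc y) - t y}"
proof
  assume fin: "finite {y. \<forall>s. w s y \<le> t (Suc y) - t y}"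
  then obtain N where N: "\<And>y. (\<forall>s. w s y \<le> t (Suc y) - t y) \<Longrightarrow> y < N"
    unfolding finite_nat_set_iff_bounded by blast
  have "\<exists>s. w s y > t (Suc y) - t y" if "y \<ge> N" for y
    using N[of y] that by (meson not_le)
  then obtain S where S: "\<And>y. y \<ge> N \<Longrightarrow> w (S y) y > t (Suc y) - t y"
    by metis
  define \<delta> where "\<delta> = w (S N) N - (t (Suc N) - t N)"
  have "\<delta> > 0" using S unfolding \<delta>_def by force
  \<comment> \<open>At a late stage s each column from N to m - 1 exceeds its increment, column N by
    at least \<delta>, so together they hold at least \<open>t m - t N + \<delta>\<close>. The
    columns below N hold at least \<open>t N\<close>.\<close>
  have step: "\<exists>s\<ge>m. t s \<ge> t m + \<delta>" if "m > N" for m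
  proof -
    define s where "s = Max (insert m (S ` {N..<m}))"
    have s: "m \<le> s" "\<And>y. y \<in> {N..<m} \<Longrightarrow> S y \<le> s"
      unfolding s_def by (rule Max_ge; simp)+
    have col: "t (Suc y) - t y + (if y = N then \<delta> else 0) \<le> w s y" if "y \<in> {N..<m}" for y
      using mono[OF s(2)[OF that], of y] S[of y] that unfolding \<delta>_def by auto
    have "t m - t N + \<delta> = (\<Sum>y=N..<m. t (Suc y) - t y) + \<delta>"
      using that by (simp add: sum_Suc_diff')
    also have "\<dots> = (\<Sum>y=N..<m. t (Suc y) - t y + (if y = N then \<delta> else 0))"
      using that by (simp add: sum.distrib)
    also have "\<dots> \<le> (\<Sum>y=N..<m. w s y)"
      by (intro sum_mono col)
    also have "\<dots> \<le> (\<Sum>y=N..<s. w s y)"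
      using s(1) nonneg by (intro sum_mono2) auto
    finally have "t m - t N + \<delta> \<le> (\<Sum>y=N..<s. w s y)" .
    moreover have "t N \<le> (\<Sum>y<N. w s y)"
      unfolding t_def using s(1) that by (intro sum_mono mono) auto
    moreover have "t s = (\<Sum>y<N. w s y) + (\<Sum>y=N..<s. w s y)"
      unfolding t_def lessThan_atLeast0 using s(1) that
      by (intro sum.atLeastLessThan_concat[symmetric]) auto
    ultimately show ?thesis using s(1) by (intro exI[of _ s]) auto
  qed
  \<comment> \<open>Iterating the gain \<delta> makes t unbounded.\<close>
  have grow: "\<exists>s>N. t s \<ge> t (Suc N) + k * \<delta>" for k :: nat
  proof (induction k)
    case 0
    then show ?case by (intro exI[of _ "Suc N"]) simp
  next
    case (Suc k)
    then obtain m where m: "m > N" "t m \<ge> t (Suc N) + k * \<delta>" by blast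
    obtain s where "s \<ge> m" "t s \<ge> t m + \<delta>" using step[OF m(1)] by blast
    with m show ?case by (intro exI[of _ s]) (auto simp: algebra_simps)
  qed
  obtain k :: nat where "b - t (Suc N) < k * \<delta>"
    using \<open>\<delta> > 0\<close> ex_less_of_nat_mult by blast
  moreover obtain s where "t s \<ge> t (Suc N) + k * \<delta>"
    using grow by blast
  ultimately show False using bound[of s] by linarith
qed

section \<open>Averaging over oracles\<close>

lemma evn_cong:
  assumes "\<And>i. i < s \<Longrightarrow> A i = B i"
  shows "evn A s p xs = evn B s p xs"
proof (cases "evn A s p xs")
  case (Suc y)
  then show ?thesis using evn_mono[OF Suc order_refl assms] by simp
next
  case 0
  show ?thesis
  proof (cases "evn B s p xs")
    case (Suc y)
    then show ?thesis using evn_mono[OF Suc order_refl assms[symmetric]] 0 by simp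
  qed (simp add: 0)
qed

text \<open>When p computes the machine, this is the approximation to \<open>W(y)\<close> at stage
  s. The one bound s limits codes of descriptions, queries and searches, so that the value is a
  finite average.\<close>

definition mean_weight :: "recf \<Rightarrow> nat \<Rightarrow> nat \<Rightarrow> real" where
  "mean_weight p s y = (\<Sum>c<s. (1 / 2) ^ length (str_decode c) *
    measure coin {A. evn A s p [c] = Suc y})"

lemma sets_evn: "{A. evn A s p xs = v} \<in> sets coin"
proof (rule coin_finitely_determined(1))
  show "(evn A s p xs = v) = (evn B s p xs = v)" if "\<And>i. i < s \<Longrightarrow> A i = B i" for A B
    using evn_cong[OF that] by simp
qed

lemma measure_evn:
  "measure coin {A. evn A s p xs = v} = (\<Sum>a<(2::nat) ^ s. of_bool (evn (bit a) s p xs = v)) / 2 ^ s"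
proof (rule coin_finitely_determined(2))
  show "(evn A s p xs = v) = (evn B s p xs = v)" if "\<And>i. i < s \<Longrightarrow> A i = B i" for A B
    using evn_cong[OF that] by simp
qed

lemma mean_weight_nonneg: "0 \<le> mean_weight p s y"
  unfolding mean_weight_def by (intro sum_nonneg) simp

lemma mean_weight_mono:
  assumes "s \<le> s'"
  shows "mean_weight p s y \<le> mean_weight p s' y"
proof -
  have "measure coin {A. evn A s p [c] = Suc y} \<le> measure coin {A. evn A s' p [c] = Suc y}" for c
    using evn_mono[OF _ assms] by (intro coin.finite_measure_mono sets_evn) blast
  then have "mean_weight p s y \<le> (\<Sum>c<s. (1 / 2) ^ length (str_decode c) *
      measure coin {A. evn A s' p [c] = Suc y})"
    unfolding mean_weight_def by (intro sum_mono mult_left_mono) simp_all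
  also have "\<dots> \<le> mean_weight p s' y"
    unfolding mean_weight_def using assms by (intro sum_mono2) auto
  finally show ?thesis .
qed

lemma mult_divide_swap: "a * (b / c) = b * (a / c)" for a b c :: real
  by simp

text \<open>The common denominator \<open>4 ^ s\<close> has one factor \<open>2 ^ s\<close> for the
  finite oracles and one for the weights of descriptions. Strings with code below s have length at
  most s, so the truncated subtraction in the exponent is exact.\<close>

lemma sum_mean_weight_eq:
  "(\<Sum>y<s. mean_weight p s y) =
    real (\<Sum>y<s. \<Sum>c<s. \<Sum>a<(2::nat) ^ s. of_bool (evn (bit a) s p [c] = Suc y) *
      2 ^ (s - length (str_decode c))) / 4 ^ s"
proof -
  have term_eq: "(1 / 2) ^ length (str_decode c) * measure coin {A. evn A s p [c] = Suc y} =
      real (\<Sum>a<(2::nat) ^ s. of_bool (evn (bit a) s p [c] = Suc y) * 2 ^ (s - length (str_decode c))) / 4 ^ s"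
    if "c < s" for c y
  proof -
    have "2 ^ length (str_decode c) \<le> Suc c"
      using str_code_range[of "str_decode c"] by simp
    then have "length (str_decode c) < Suc c"
      using less_exp[of "length (str_decode c)"] by linarith
    then have "length (str_decode c) \<le> s" using that by simp
    then have scale: "(1 / 2) ^ length (str_decode c) / 2 ^ s = (2 ^ (s - length (str_decode c)) / 4 ^ s :: real)"
      by (simp add: power_diff power_one_over field_simps flip: power_mult_distrib)
    let ?S = "\<Sum>a<(2::nat) ^ s. of_bool (evn (bit a) s p [c] = Suc y) :: real"
    have "(1 / 2) ^ length (str_decode c) * (?S / 2 ^ s) =
        ?S * ((1 / 2) ^ length (str_decode c) / 2 ^ s)"
      by (rule mult_divide_swap)
    also have "\<dots> = ?S * 2 ^ (s - length (str_decode c)) / 4 ^ s"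
      unfolding scale by (simp only: times_divide_eq_right)
    finally show ?thesis
      unfolding measure_evn
      by (simp only: sum_distrib_right of_nat_sum of_nat_mult of_nat_of_bool of_nat_power of_nat_numeral)
  qed
  have "(\<Sum>y<s. mean_weight p s y) = (\<Sum>y<s. \<Sum>c<s. real (\<Sum>a<(2::nat) ^ s.
      of_bool (evn (bit a) s p [c] = Suc y) * 2 ^ (s - length (str_decode c))) / 4 ^ s)"
    unfolding mean_weight_def by (intro sum.cong refl term_eq) simp
  then show ?thesis by (simp add: sum_divide_distrib)
qed

text \<open>For each oracle a description has at most one output, so summing over y counts it at
  most once and the Kraft inequality applies. Averaging preserves the bound.\<close>

lemma sum_mean_weight_le_1:
  assumes p: "\<And>X \<sigma> \<tau>. U X \<sigma> = Some \<tau> \<longleftrightarrow> oeval X p [str_code \<sigma>] (str_code \<tau>)"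
    and pf: "\<And>X. prefix_free (dom (U X))"
  shows "(\<Sum>y<s. mean_weight p s y) \<le> 1"
proof -
  let ?l = "\<lambda>c. (1 / 2 :: real) ^ length (str_decode c)"
  have le: "(\<Sum>y<s. b * of_bool (v = Suc y)) \<le> b * of_bool (v \<noteq> 0)" if "b \<ge> 0" for v and b :: real
  proof (cases v)
    case (Suc z)
    have "(\<Sum>y<s. b * of_bool (v = Suc y)) = (\<Sum>y<s. if y = z then b else 0)"
      by (intro sum.cong refl) (auto simp: Suc)
    also have "\<dots> \<le> b" using that by simp
    finally show ?thesis using Suc by simp
  qed simp
  have each_real: "(\<Sum>c<s. \<Sum>y<s. ?l c * of_bool (evn X s p [c] = Suc y)) \<le> 1" for X
  proof -
    let ?H = "{..<s} \<inter> {c. evn X s p [c] \<noteq> 0}"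
    have inj: "inj_on str_decode ?H" by (rule inj_on_inverseI[of _ str_code]) simp
    have "(\<Sum>c<s. \<Sum>y<s. ?l c * of_bool (evn X s p [c] = Suc y)) \<le>
        (\<Sum>c<s. ?l c * of_bool (evn X s p [c] \<noteq> 0))"
      by (intro sum_mono le) simp
    also have "\<dots> = (\<Sum>c\<in>?H. ?l c)"
      by (simp only: sum_mult_of_bool_eq finite_lessThan)
    also have "\<dots> = (\<Sum>\<sigma>\<in>str_decode ` ?H. (1 / 2) ^ length \<sigma>)"
      using inj by (simp only: sum.reindex o_def)
    also have "\<dots> \<le> 1"
    proof (rule kraft_inequality)
      have "str_decode ` ?H \<subseteq> dom (U X)"
      proof
        fix \<sigma>
        assume "\<sigma> \<in> str_decode ` ?H"
        then obtain y where "evn X s p [str_code \<sigma>] = Suc y"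
          by (auto simp: gr0_conv_Suc)
        then have "U X \<sigma> = Some (str_decode y)"
          using p evn_imp_oeval by simp
        then show "\<sigma> \<in> dom (U X)" by blast
      qed
      then show "prefix_free (str_decode ` ?H)"
        using pf[of X] unfolding prefix_free_def by blast
    qed simp
    finally show ?thesis .
  qed
  have "(\<Sum>y<s. mean_weight p s y) =
      (\<Sum>y<s. \<Sum>c<s. \<Sum>a<(2::nat) ^ s. ?l c * of_bool (evn (bit a) s p [c] = Suc y)) / 2 ^ s"
    unfolding mean_weight_def measure_evn
    by (simp only: sum_divide_distrib sum_distrib_left times_divide_eq_right)
  \<comment> \<open>The sum over oracles is moved outermost, so that the bound for a single oracle
    applies.\<close>
  also have "(\<Sum>y<s. \<Sum>c<s. \<Sum>a<(2::nat) ^ s. ?l c * of_bool (evn (bit a) s p [c] = Suc y)) =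
      (\<Sum>y<s. \<Sum>a<(2::nat) ^ s. \<Sum>c<s. ?l c * of_bool (evn (bit a) s p [c] = Suc y))"
    by (intro sum.cong refl sum.swap)
  also have "\<dots> = (\<Sum>a<(2::nat) ^ s. \<Sum>y<s. \<Sum>c<s. ?l c * of_bool (evn (bit a) s p [c] = Suc y))"
    by (rule sum.swap)
  also have "\<dots> = (\<Sum>a<(2::nat) ^ s. \<Sum>c<s. \<Sum>y<s. ?l c * of_bool (evn (bit a) s p [c] = Suc y))"
    by (intro sum.cong refl sum.swap)
  finally have "(\<Sum>y<s. mean_weight p s y) =
      (\<Sum>a<(2::nat) ^ s. \<Sum>c<s. \<Sum>y<s. ?l c * of_bool (evn (bit a) s p [c] = Suc y)) / 2 ^ s" .
  also have "\<dots> \<le> (\<Sum>a<(2::nat) ^ s. 1) / 2 ^ s"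
    by (intro divide_right_mono sum_mono each_real) simp
  finally show ?thesis by simp
qed

lemma ocomputable_mean_weight_numerator:
  "ocomputable (Suc 0) (\<lambda>X xs. \<Sum>y<hd xs. \<Sum>c<hd xs. \<Sum>a<(2::nat) ^ hd xs.
    of_bool (evn (bit a) (hd xs) p [c] = Suc y) * 2 ^ (hd xs - length (str_decode c)))"
proof -
  \<comment> \<open>Under the three sums the context is a, c, y, s, while \<open>evn\<close> expects
    the stage, the oracle and the input.\<close>
  have "ocomputable_list (Suc (Suc (Suc (Suc 0)))) (Suc (Suc (Suc 0)))
      (\<lambda>X ys. [hd (tl (tl (tl ys))), hd ys, hd (tl ys)])"
    by (intro ocomp)
  from ocomputable_subst[OF this ocomputable_evn]
  have "ocomputable (Suc (Suc (Suc (Suc 0))))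
      (\<lambda>X ys. evn (bit (hd ys)) (hd (tl (tl (tl ys)))) p [hd (tl ys)])" by simp
  then show ?thesis by (intro ocomp)
qed

lemma weakly_low_probable:
  assumes U: "universal_machine U"
  obtains d where
    "\<And>y. {A. \<forall>\<tau>. U A \<tau> = Some (str_decode y) \<longrightarrow> K U (str_decode y) \<le> length \<tau> + d} \<in> sets coin"
    "infinite {y. 3 / 4 \<le>
      measure coin {A. \<forall>\<tau>. U A \<tau> = Some (str_decode y) \<longrightarrow> K U (str_decode y) \<le> length \<tau> + d}}"
proof -
  obtain p where p: "\<And>X \<sigma> \<tau>. U X \<sigma> = Some \<tau> \<longleftrightarrow> oeval X p [str_code \<sigma>] (str_code \<tau>)"
    using U unfolding universal_machine_def prefix_free_machine_def partial_computable_def by blast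
  have pf: "prefix_free (dom (U X))" for X
    using U unfolding universal_machine_def prefix_free_machine_def by blast
  define t where "t s = (\<Sum>y<s. mean_weight p s y)" for s
  have t_le: "t s \<le> 1" for s
    unfolding t_def by (rule sum_mean_weight_le_1[OF p pf])
  have "incseq t"
  proof (rule incseq_SucI)
    fix s
    have "t s \<le> (\<Sum>y<s. mean_weight p (Suc s) y)"
      unfolding t_def by (intro sum_mono mean_weight_mono) simp
    then show "t s \<le> t (Suc s)"
      unfolding t_def using mean_weight_nonneg[of p "Suc s" s] by simp
  qed
  then obtain c where c: "\<And>s. t (Suc s) - t s \<le> 2 ^ c * (1 / 2) ^ K U (str_decode s)"
    using universal_machine_increments[OF U ocomputable_mean_weight_numerator[of p]] t_le
    unfolding t_def sum_mean_weight_eq by blast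
  have inf: "infinite {y. \<forall>s. mean_weight p s y \<le> t (Suc y) - t y}"
    unfolding t_def
    by (rule infinite_columns_le_increments[where b = 1])
      (simp_all add: mean_weight_nonneg mean_weight_mono t_le[unfolded t_def])
  \<comment> \<open>The 2 makes the final Markov bound \<open>2 ^ c * (1 / 2) ^ d\<close> equal to
    1/4.\<close>
  define d where "d = c + 2"
  \<comment> \<open>Failures seen by stage s depend on finitely many bits of A. Their increasing
    union is the complement of \<open>Good y\<close>, which gives both its measurability and its
    probability as a limit.\<close>
  define Bad where "Bad y s =
    {A. \<exists>x<s. evn A s p [x] = Suc y \<and> length (str_decode x) + d < K U (str_decode y)}" for y s
  define Good where "Good y =
    {A. \<forall>\<tau>. U A \<tau> = Some (str_decode y) \<longrightarrow> K U (str_decode y) \<le> length \<tau> + d}" for y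
  have Bad_sets: "Bad y s \<in> sets coin" for y s
    unfolding Bad_def
  proof (rule coin_finitely_determined(1))
    fix A B :: cantor
    assume "\<And>i. i < s \<Longrightarrow> A i = B i"
    from evn_cong[OF this]
    show "(\<exists>x<s. evn A s p [x] = Suc y \<and> length (str_decode x) + d < K U (str_decode y)) \<longleftrightarrow>
        (\<exists>x<s. evn B s p [x] = Suc y \<and> length (str_decode x) + d < K U (str_decode y))"
      by simp
  qed
  have Bad_mono: "Bad y s \<subseteq> Bad y s'" if "s \<le> s'" for y s s'
    unfolding Bad_def using evn_mono[OF _ that] less_le_trans[OF _ that] by blast
  have compl: "UNIV - Good y = (\<Union>s. Bad y s)" for y
  proof (intro subset_antisym subsetI)
    fix A
    assume "A \<in> UNIV - Good y"
    then obtain \<tau> where \<tau>: "U A \<tau> = Some (str_decode y)" "length \<tau> + d < K U (str_decode y)"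
      unfolding Good_def by (auto simp: not_le)
    then obtain s where s: "evn A s p [str_code \<tau>] = Suc y"
      using p oeval_imp_evn by fastforce
    have "evn A (max s (Suc (str_code \<tau>))) p [str_code \<tau>] = Suc y"
      using evn_mono[OF s, of "max s (Suc (str_code \<tau>))" A] by simp
    then have "A \<in> Bad y (max s (Suc (str_code \<tau>)))"
      unfolding Bad_def using \<tau>(2)
      by (intro CollectI exI[of _ "str_code \<tau>"]) simp
    then show "A \<in> (\<Union>s. Bad y s)" by blast
  next
    fix A
    assume "A \<in> (\<Union>s. Bad y s)"
    then obtain s x where x: "evn A s p [x] = Suc y" "length (str_decode x) + d < K U (str_decode y)"
      unfolding Bad_def by blast
    have "U A (str_decode x) = Some (str_decode y)"
      unfolding p using evn_imp_oeval[OF x(1)] by simp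
    then show "A \<in> UNIV - Good y"
      unfolding Good_def using x(2) by force
  qed
  have UN_sets: "(\<Union>s. Bad y s) \<in> sets coin" for y
    by (rule sets.countable_UN'') (rule countableI_type, rule Bad_sets)
  have Good_eq: "Good y = space coin - (\<Union>s. Bad y s)" for y
    using compl[of y] by auto
  then have Good_sets: "Good y \<in> sets coin" for y
    using UN_sets by (simp only: sets.compl_sets)
  \<comment> \<open>Markov's inequality as a union bound: each description that is too short has
    weight at least \<open>(1 / 2) ^ (K U (str_decode y) - d)\<close>.\<close>
  have Bad_le: "measure coin (Bad y s) \<le> 2 ^ (K U (str_decode y) - d) * mean_weight p s y" for y s
  proof -
    let ?I = "{x. x < s \<and> length (str_decode x) + d < K U (str_decode y)}"
    let ?E = "\<lambda>x. {A. evn A s p [x] = Suc y}"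
    let ?e = "K U (str_decode y) - d"
    have weight: "1 \<le> 2 ^ ?e * (1 / 2 :: real) ^ length (str_decode x)" if "x \<in> ?I" for x
    proof -
      have "(2::real) ^ length (str_decode x) \<le> 2 ^ ?e"
        using that by (intro power_increasing) auto
      then show ?thesis by (simp add: power_one_over field_simps)
    qed
    have "Bad y s = (\<Union>x\<in>?I. ?E x)" unfolding Bad_def by blast
    then have "measure coin (Bad y s) \<le> (\<Sum>x\<in>?I. measure coin (?E x))"
      by (simp only:, intro coin.finite_measure_subadditive_finite)
        (simp, use sets_evn in blast)
    also have "\<dots> \<le> (\<Sum>x\<in>?I. 2 ^ ?e * ((1 / 2) ^ length (str_decode x) * measure coin (?E x)))"
    proof (rule sum_mono)
      fix x
      assume "x \<in> ?I"
      from mult_right_mono[OF weight[OF this], of "measure coin (?E x)"]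
      show "measure coin (?E x) \<le>
          2 ^ ?e * ((1 / 2) ^ length (str_decode x) * measure coin (?E x))"
        by (simp add: mult.assoc)
    qed
    also have "\<dots> \<le> (\<Sum>x<s. 2 ^ ?e * ((1 / 2) ^ length (str_decode x) * measure coin (?E x)))"
      by (rule sum_mono2) auto
    also have "\<dots> = 2 ^ ?e * mean_weight p s y"
      unfolding mean_weight_def sum_distrib_left ..
    finally show ?thesis .
  qed
  have "3 / 4 \<le> measure coin (Good y)" if y: "\<And>s. mean_weight p s y \<le> t (Suc y) - t y" for y
  proof -
    have "measure coin (Bad y s) \<le> 1 / 4" for s
    \<comment> \<open>The exponent in \<open>Bad_le\<close> is a truncated difference, exact only in
      the first case; in the second no description can be too short.\<close>
    proof (cases "d \<le> K U (str_decode y)")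
      case True
      then have K: "K U (str_decode y) = (K U (str_decode y) - d) + d" by simp
      have "measure coin (Bad y s) \<le>
          2 ^ (K U (str_decode y) - d) * (2 ^ c * (1 / 2) ^ K U (str_decode y))"
        using order_trans[OF y[of s] c[of y]]
        by (intro order_trans[OF Bad_le] mult_left_mono) simp_all
      also have "\<dots> = 2 ^ c * (1 / 2) ^ d"
        by (subst (2) K) (simp add: power_add power_one_over)
      also have "\<dots> = 1 / 4"
        by (simp add: d_def power_add power_one_over)
      finally show ?thesis .
    next
      case False
      then have "Bad y s = {}" unfolding Bad_def by simp
      then show ?thesis by simp
    qed
    moreover have "(\<lambda>s. measure coin (Bad y s)) \<longlonglongrightarrow> measure coin (\<Union>s. Bad y s)"
      using Bad_sets Bad_mono
      by (intro coin.finite_Lim_measure_incseq) (simp_all add: image_subset_iff incseq_def)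
    ultimately have "measure coin (\<Union>s. Bad y s) \<le> 1 / 4"
      by (intro LIMSEQ_le_const2) auto
    moreover have "measure coin (Good y) = 1 - measure coin (\<Union>s. Bad y s)"
      unfolding Good_eq by (rule coin.prob_compl) (rule UN_sets)
    ultimately show ?thesis by simp
  qed
  then have "{y. \<forall>s. mean_weight p s y \<le> t (Suc y) - t y} \<subseteq> {y. 3 / 4 \<le> measure coin (Good y)}"
    by blast
  then have "infinite {y. 3 / 4 \<le> measure coin (Good y)}"
    using inf finite_subset by blast
  with Good_sets show ?thesis
    unfolding Good_def by (rule that)
qed

section \<open>Incompressible initial segments\<close>

text \<open>Shortest descriptions are distinct for distinct strings, and a string of length below m
  has a code below \<open>2 ^ m\<close>.\<close>

lemma card_compressible:
  assumes U: "universal_machine U"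
  shows "finite {\<sigma>. length \<sigma> = n \<and> K U \<sigma> < m}" "card {\<sigma>. length \<sigma> = n \<and> K U \<sigma> < m} \<le> 2 ^ m"
proof -
  let ?S = "{\<sigma>. length \<sigma> = n \<and> K U \<sigma> < m}"
  show "finite ?S"
    using finite_lists_length_eq[of "UNIV :: bool set" n] by (rule rev_finite_subset) auto
  have "\<exists>\<tau>. length \<tau> = K U \<sigma> \<and> U empty_oracle \<tau> = Some \<sigma>" for \<sigma>
    using KO_attained[OF U] by metis
  then obtain D where D: "\<And>\<sigma>. length (D \<sigma>) = K U \<sigma>" "\<And>\<sigma>. U empty_oracle (D \<sigma>) = Some \<sigma>"
    by metis
  have "inj D" by (rule injI) (metis D(2) option.inject)
  then have "inj_on (\<lambda>\<sigma>. str_code (D \<sigma>)) ?S"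
    unfolding inj_on_def inj_def by simp
  moreover have "(\<lambda>\<sigma>. str_code (D \<sigma>)) ` ?S \<subseteq> {..<2 ^ m}"
  proof
    fix x
    assume "x \<in> (\<lambda>\<sigma>. str_code (D \<sigma>)) ` ?S"
    then obtain \<sigma> where \<sigma>: "K U \<sigma> < m" "x = str_code (D \<sigma>)" by blast
    have "Suc (str_code (D \<sigma>)) < 2 ^ Suc (length (D \<sigma>))"
      using str_code_range by blast
    also have "\<dots> \<le> 2 ^ m"
      using \<sigma>(1) D(1) by (intro power_increasing) simp_all
    finally show "x \<in> {..<2 ^ m}" using \<sigma>(2) by simp
  qed
  ultimately show "card ?S \<le> 2 ^ m"
    using card_inj_on_le[of "\<lambda>\<sigma>. str_code (D \<sigma>)" ?S "{..<2 ^ m}"] by simp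
qed

text \<open>At most \<open>2 ^ (n - d)\<close> strings of length n are too compressible, and each is
  an initial segment of A with probability \<open>(1 / 2) ^ n\<close>. For n < d there are
  none.\<close>

lemma incompressible_probable:
  assumes U: "universal_machine U"
  shows "{A. n \<le> K U (map A [0..<n]) + d} \<in> sets coin"
    and "1 - (1 / 2) ^ d \<le> measure coin {A. n \<le> K U (map A [0..<n]) + d}"
proof -
  let ?S = "{\<sigma>. length \<sigma> = n \<and> K U \<sigma> < n - d}"
  let ?C = "\<lambda>\<sigma>. {A. map A [0..<length \<sigma>] = \<sigma>}"
  note S = card_compressible[OF U, of n "n - d"]
  have Un: "(\<Union>\<sigma>\<in>?S. ?C \<sigma>) \<in> sets coin"
    by (rule sets.finite_UN[OF S(1)]) (rule coin_cylinder_str(1))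
  have eq: "{A. n \<le> K U (map A [0..<n]) + d} = space coin - (\<Union>\<sigma>\<in>?S. ?C \<sigma>)"
  proof (rule set_eqI)
    fix A
    have "A \<in> (\<Union>\<sigma>\<in>?S. ?C \<sigma>) \<longleftrightarrow> K U (map A [0..<n]) < n - d" by auto
    moreover have "n \<le> k + d \<longleftrightarrow> \<not> k < n - d" for k by arith
    ultimately show "A \<in> {A. n \<le> K U (map A [0..<n]) + d} \<longleftrightarrow> A \<in> space coin - (\<Union>\<sigma>\<in>?S. ?C \<sigma>)"
      by (simp only: space_coin mem_Collect_eq Diff_iff UNIV_I simp_thms)
  qed
  show "{A. n \<le> K U (map A [0..<n]) + d} \<in> sets coin"
    unfolding eq by (rule sets.compl_sets[OF Un])
  have "measure coin (\<Union>\<sigma>\<in>?S. ?C \<sigma>) \<le> (1 / 2) ^ d"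
  proof (cases "d \<le> n")
    case True
    have "measure coin (\<Union>\<sigma>\<in>?S. ?C \<sigma>) \<le> (\<Sum>\<sigma>\<in>?S. measure coin (?C \<sigma>))"
      by (rule coin.finite_measure_subadditive_finite[OF S(1)])
        (rule image_subsetI, rule coin_cylinder_str(1))
    also have "\<dots> = (\<Sum>\<sigma>\<in>?S. (1 / 2) ^ n)"
    proof (rule sum.cong[OF refl])
      fix \<sigma>
      assume "\<sigma> \<in> ?S"
      then have "length \<sigma> = n" by simp
      with coin_cylinder_str(2)[of \<sigma>] show "measure coin (?C \<sigma>) = (1 / 2) ^ n"
        by (simp only:)
    qed
    also have "\<dots> = real (card ?S) * (1 / 2) ^ n" by simp
    also have "\<dots> \<le> real (2 ^ (n - d)) * (1 / 2) ^ n"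
      using S(2) by (intro mult_right_mono of_nat_mono) simp_all
    also have "\<dots> = (1 / 2) ^ d"
      using True by (auto simp: le_iff_add power_add power_one_over)
    finally show ?thesis .
  next
    case False
    then have "?S = {}" by simp
    then show ?thesis by (simp only: UN_empty measure_empty) simp
  qed
  then show "1 - (1 / 2) ^ d \<le> measure coin {A. n \<le> K U (map A [0..<n]) + d}"
    unfolding eq coin.prob_compl[OF Un] by simp
qed

section \<open>The main result\<close>

lemma computable_rel_odecidable:
  assumes "odecidable k (\<lambda>X. R)"
  shows "computable_rel k R"
  using assms unfolding odecidable_def ocomputable_def computable_rel_def of_bool_def by blast

text \<open>Both quantifiers range over dummy variables, dropped by
  \<open>tl (tl xs)\<close>.\<close>

lemma Delta02_odecidable:
  assumes "odecidable k (\<lambda>X. R)"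
  shows "Delta02 k R"
proof -
  have "odecidable (k + 2) (\<lambda>X xs. R (tl (tl xs)))"
    using ocomputable_subst[OF ocomputable_list_tl2 assms[unfolded odecidable_def]]
    unfolding odecidable_def by simp
  from computable_rel_odecidable[OF this] show ?thesis
    unfolding Delta02_def Sigma02_def Pi02_def by (auto intro!: exI[of _ "\<lambda>xs. R (tl (tl xs))"])
qed

text \<open>On a segment of length 3 n, the order and the unary description from the oracle cost n
  each, so membership in \<open>LK\<close> would bound the complexity by 2 n + O(1), below the 3 n
  of an incompressible segment.\<close>

definition third_length :: "str \<Rightarrow> nat" where
  "third_length \<sigma> = length \<sigma> div 3"

lemma Delta02_fun_third_length: "Delta02_fun third_length"
proof -
  have "odecidable (Suc (Suc 0)) (\<lambda>X xs. hd (tl xs) = length (str_decode (hd xs)) div 3)"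
    by (intro ocomp)
  from Delta02_odecidable[OF this]
  have D: "Delta02 2 (\<lambda>xs. hd (tl xs) = length (str_decode (hd xs)) div 3)"
    by (simp add: numeral_2_eq_2)
  have "(\<exists>\<sigma>. xs = [str_code \<sigma>, third_length \<sigma>]) \<longleftrightarrow>
      hd (tl xs) = length (str_decode (hd xs)) div 3" if "length xs = 2" for xs
  proof -
    obtain x y where xs: "xs = [x, y]"
      using \<open>length xs = 2\<close> by (auto simp: numeral_2_eq_2 length_Suc_conv)
    have "x = str_code \<sigma> \<longleftrightarrow> \<sigma> = str_decode x" for \<sigma>
      by (metis str_code_decode str_decode_code)
    then show ?thesis unfolding xs third_length_def by simp
  qed
  with D show ?thesis
    unfolding Delta02_fun_def Delta02_def Sigma02_def Pi02_def by simp
qed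

lemma is_order_third_length: "is_order third_length"
  unfolding is_order_def
proof (intro conjI allI impI)
  fix \<sigma> \<tau> :: str
  assume "str_code \<sigma> \<le> str_code \<tau>"
  then have "(2::nat) ^ length \<sigma> < 2 ^ Suc (length \<tau>)"
    using str_code_range[of \<sigma>] str_code_range[of \<tau>] by linarith
  then have "length \<sigma> \<le> length \<tau>"
    by (simp add: power_strict_increasing_iff del: power_Suc)
  then show "third_length \<sigma> \<le> third_length \<tau>"
    unfolding third_length_def by (rule div_le_mono)
next
  fix n
  show "\<exists>\<sigma>. n \<le> third_length \<sigma>"
    by (rule exI[of _ "replicate (3 * n) False"]) (simp add: third_length_def)
qed

text \<open>The oracle supplies the bits, so only n has to be described, which is done in
  unary.\<close>

lemma KO_initial_segment_le:
  assumes U: "universal_machine U"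
  shows "\<exists>c. \<forall>A n. KO U A (map A [0..<3 * n]) \<le> n + c"
proof -
  \<comment> \<open>Appending a bit doubles the code and adds 1 or 2, so the code of a segment
    arises by primitive recursion with oracle queries.\<close>
  have code: "str_code (map A [0..<m]) = rec_nat 0 (\<lambda>i r. 2 * r + Suc (of_bool (A i))) m" for A m
    by (induction m) simp_all
  have "ocomputable (Suc 0) (\<lambda>X xs. rec_nat 0 (\<lambda>i r. 2 * r + Suc (of_bool (X i))) (3 * hd xs))"
    by (intro ocomp)
  then have "ocomputable (Suc 0) (\<lambda>X xs. str_code (map X [0..<3 * hd xs]))"
    unfolding code .
  from universal_machine_unary[OF U this]
  obtain c where c: "\<And>X n. \<exists>\<tau>. length \<tau> = n + c \<and> U X \<tau> = Some (map X [0..<3 * n])"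
    unfolding str_decode_code by blast
  have "KO U A (map A [0..<3 * n]) \<le> n + c" for A n
    using c[where X = A and n = n] KO_le by metis
  then show ?thesis by blast
qed

theorem mainTheorem5:
  fixes U :: "cantor \<Rightarrow> str \<Rightarrow> str option"
  assumes "universal_machine U"
  shows "\<exists>A. weakly_low_for_K U A \<and> A \<notin> LK_Delta02 U"
proof -
  obtain d where
    "\<And>y. {A. \<forall>\<tau>. U A \<tau> = Some (str_decode y) \<longrightarrow> K U (str_decode y) \<le> length \<tau> + d} \<in> sets coin"
    "infinite {y. 3 / 4 \<le>
      measure coin {A. \<forall>\<tau>. U A \<tau> = Some (str_decode y) \<longrightarrow> K U (str_decode y) \<le> length \<tau> + d}}"
    using weakly_low_probable[OF assms] by blast
  note low = coin.prob_infinitely_often_ge[OF this, unfolded mem_Collect_eq space_coin]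
  \<comment> \<open>With the deficiency 2 the probability is at least 1 - 1/4 for every n, so the
    set consists of all numbers.\<close>
  have "infinite {n. 3 / 4 \<le> measure coin {A. 3 * n \<le> K U (map A [0..<3 * n]) + 2}}"
    using incompressible_probable(2)[OF assms, of 2] by (simp add: power2_eq_square)
  note random = coin.prob_infinitely_often_ge[OF incompressible_probable(1)[OF assms] this,
      unfolded mem_Collect_eq space_coin]
  let ?L = "{A \<in> UNIV. infinite {y. \<forall>\<tau>. U A \<tau> = Some (str_decode y) \<longrightarrow>
    K U (str_decode y) \<le> length \<tau> + d}}"
  let ?R = "{A \<in> UNIV. infinite {n. 3 * n \<le> K U (map A [0..<3 * n]) + 2}}"
  \<comment> \<open>Two events of probability at least 3/4 cannot be disjoint.\<close>
  have "?L \<inter> ?R \<noteq> {}"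
  proof
    assume "?L \<inter> ?R = {}"
    then have "measure coin (?L \<union> ?R) = measure coin ?L + measure coin ?R"
      by (rule coin.finite_measure_Union[OF low(1) random(1)])
    then show False
      using low(2) random(2) coin.prob_le_1[of "?L \<union> ?R"] by linarith
  qed
  then obtain A where A: "A \<in> ?L" "A \<in> ?R" by blast
  have "infinite {\<sigma>. K U \<sigma> \<le> KO U A \<sigma> + d}"
  proof
    assume "finite {\<sigma>. K U \<sigma> \<le> KO U A \<sigma> + d}"
    then have "finite (str_code ` {\<sigma>. K U \<sigma> \<le> KO U A \<sigma> + d})" by simp
    moreover have "{y. \<forall>\<tau>. U A \<tau> = Some (str_decode y) \<longrightarrow> K U (str_decode y) \<le> length \<tau> + d} \<subseteq>
        str_code ` {\<sigma>. K U \<sigma> \<le> KO U A \<sigma> + d}"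
    proof
      fix y
      assume y: "y \<in> {y. \<forall>\<tau>. U A \<tau> = Some (str_decode y) \<longrightarrow>
        K U (str_decode y) \<le> length \<tau> + d}"
      \<comment> \<open>A shortest description from A turns the bound over all descriptions into one
        by \<open>KO U A\<close>.\<close>
      obtain \<tau> where "length \<tau> = KO U A (str_decode y)" "U A \<tau> = Some (str_decode y)"
        using KO_attained[OF assms] by metis
      with y have "K U (str_decode y) \<le> KO U A (str_decode y) + d" by force
      then show "y \<in> str_code ` {\<sigma>. K U \<sigma> \<le> KO U A \<sigma> + d}"
        by (intro image_eqI[of _ _ "str_decode y"]) simp_all
    qed
    ultimately show False using A(1) finite_subset by blast
  qed
  then have "weakly_low_for_K U A"
    unfolding weakly_low_for_K_def by blast
  moreover have "A \<notin> LK U third_length"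
  proof
    assume "A \<in> LK U third_length"
    then obtain c where c: "\<And>\<sigma>. K U \<sigma> \<le> KO U A \<sigma> + third_length \<sigma> + c"
      unfolding LK_def by blast
    obtain c' where c': "\<And>n. KO U A (map A [0..<3 * n]) \<le> n + c'"
      using KO_initial_segment_le[OF assms] by blast
    have "n \<le> c + c' + 2" if "3 * n \<le> K U (map A [0..<3 * n]) + 2" for n
      using that c[of "map A [0..<3 * n]"] c'[of n] by (simp add: third_length_def)
    then have "{n. 3 * n \<le> K U (map A [0..<3 * n]) + 2} \<subseteq> {..c + c' + 2}" by blast
    then show False using A(2) finite_subset by blast
  qed
  then have "A \<notin> LK_Delta02 U"
    unfolding LK_Delta02_def using Delta02_fun_third_length is_order_third_length by blast
  ultimately show ?thesis by blast
qed

end
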